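(* Let $k\geq 1$ be an integer. Let $Q_1,\ldots,Q_{2k+1}\geq 1$ and let $A_1,\ldots,A_{2k+1}\subseteq[-1,1]$ be intervals of lengths $\delta_1,\ldots,\delta_{2k+1}$ respectively, where $\delta_i\geq 1/Q_i$ for $1\leq i\leq 2k+1$. Then there exists some $X\subseteq\{1,\ldots,2k+1\}$ with $|X|=k+1$ such that the number of tuples of integers $(a_1,\ldots,a_{2k+1},q_1,\ldots,q_{2k+1})$ with $1\le q_i\leq Q_i$, $\gcd(a_i,q_i)=1$ and $a_i/q_i\in A_i$ for $1\leq i\leq 2k+1$, such that \[\frac{a_1}{q_1}+\cdots+\frac{a_{2k+1}}{q_{2k+1}}\in\mathbb{Z},\] is \[\ll_k (\log(Q_1\cdots Q_{2k+1}))^{O_k(1)}\left(\prod_{i\in X}\delta_i\right)Q_1\cdots Q_{2k+1}.\]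
   Context: The notation $f\ll_k g$ means $|f|\leq C_k g$ for a constant $C_k$ depending only on $k$; $O_k(1)$ denotes a quantity bounded in terms of $k$ only. *)

theory Defs
  imports "HOL-Analysis.Analysis"
begin

text \<open>
  Tuples \<open>(a\<^sub>1, \<dots>, a\<^sub>n)\<close> and \<open>(q\<^sub>1, \<dots>, q\<^sub>n)\<close> are extensional functions on \<open>{1..n}\<close>, so that
  distinct tuples correspond to distinct functions. The bounds \<open>Q i\<close> are arbitrary reals.
\<close>

definition integral_fraction_tuples ::
    "nat \<Rightarrow> (nat \<Rightarrow> real) \<Rightarrow> (nat \<Rightarrow> real set) \<Rightarrow> ((nat \<Rightarrow> int) \<times> (nat \<Rightarrow> int)) set" where
  "integral_fraction_tuples n Q A =
     {(a, q). a \<in> {1..n} \<rightarrow>\<^sub>E UNIV \<and> q \<in> {1..n} \<rightarrow>\<^sub>E UNIV \<and>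
        (\<forall>i\<in>{1..n}. 1 \<le> q i \<and> real_of_int (q i) \<le> Q i \<and> coprime (a i) (q i) \<and>
           real_of_int (a i) / real_of_int (q i) \<in> A i) \<and>
        (\<Sum>i=1..n. real_of_int (a i) / real_of_int (q i)) \<in> \<int>}"

text \<open>In the intended situation the set is finite, so its cardinality is a genuine count.\<close>

lemma finite_integral_fraction_tuples:
  assumes "\<And>i. i \<in> {1..n} \<Longrightarrow> A i \<subseteq> {-1..1}"
  shows "finite (integral_fraction_tuples n Q A)"
proof (rule finite_subset)
  let ?P = "{1..n} \<rightarrow>\<^sub>E (UNIV :: int set)"
  let ?B = "(\<Pi>\<^sub>E i\<in>{1..n}. {-\<lfloor>Q i\<rfloor>..\<lfloor>Q i\<rfloor>})"
  show "finite (?B \<times> ?B)"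
    by (intro finite_cartesian_product finite_PiE) auto
  show "integral_fraction_tuples n Q A \<subseteq> ?B \<times> ?B"
  proof (clarify)
    fix a q assume aq: "(a, q) \<in> integral_fraction_tuples n Q A"
    have *: "a i \<in> {-\<lfloor>Q i\<rfloor>..\<lfloor>Q i\<rfloor>} \<and> q i \<in> {-\<lfloor>Q i\<rfloor>..\<lfloor>Q i\<rfloor>}" if i: "i \<in> {1..n}" for i
    proof -
      have q: "1 \<le> q i" "q i \<le> \<lfloor>Q i\<rfloor>" and mem: "real_of_int (a i) / real_of_int (q i) \<in> A i"
        using aq i unfolding integral_fraction_tuples_def by (auto simp: le_floor_iff)
      from mem assms[OF i] have "real_of_int (a i) / real_of_int (q i) \<in> {-1..1}"
        by blast
      with q have "- real_of_int (q i) \<le> real_of_int (a i)" "real_of_int (a i) \<le> real_of_int (q i)"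
        by (auto simp: field_simps)
      with q show ?thesis by auto
    qed
    show "a \<in> ?B \<and> q \<in> ?B"
      using aq * unfolding integral_fraction_tuples_def by (auto simp: PiE_iff)
  qed
qed

end

theory Submission
  imports Defs "HOL-Library.Discrete_Functions"
begin

text \<open>
  Order the indices, and let \<open>w\<^sub>i\<close> and \<open>v\<^sub>i\<close> be the quotients of \<open>q\<^sub>i\<close> by its gcd with the lcm of
  the earlier and of the later denominators, respectively. Since the sum is an integer, \<open>w\<^sub>i\<close> and
  \<open>v\<^sub>i\<close> are coprime; moreover \<open>\<Prod>w\<^sub>i = \<Prod>v\<^sub>i\<close>, as both products are the lcm of all \<open>q\<^sub>i\<close>.
  Choose the fractions one after the other. Given the earlier ones, \<open>g = q\<^sub>i / w\<^sub>i\<close> and \<open>v = v\<^sub>i\<close>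
  (divisors of the lcm of the earlier denominators), the candidates for \<open>a\<^sub>i / q\<^sub>i\<close> with
  \<open>w\<^sub>i \<sim> W\<close> are \<open>v / (4 g W\<^sup>2)\<close>-separated, so there are \<open>O(1 + \<delta>\<^sub>i g W\<^sup>2 / v)\<close> of them.
  Weighted by \<open>v\<^sub>i / w\<^sub>i\<close> this is \<open>O(\<delta>\<^sub>i Q\<^sub>i)\<close> if \<open>v\<^sub>i \<le> w\<^sub>i\<close> and \<open>O(Q\<^sub>i)\<close> otherwise, and the
  weights of a whole tuple multiply to 1. Reversing the order exchanges \<open>v\<close> and \<open>w\<close>, so in one of
  the two directions at least \<open>k + 1\<close> of the \<open>2 k + 1\<close> indices gain a factor \<open>\<delta>\<^sub>i\<close>.

  The number of choices of \<open>g\<close> and \<open>v\<close> is a power of the divisor counts \<open>\<tau>(q\<^sub>i)\<close>, which is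
  polylogarithmic only on average. Only the first fraction can be averaged over freely, so it should
  carry the largest divisor count, in both directions. This is possible because every \<open>q\<^sub>j\<close>
  divides the product of the others: the largest divisor count is at most a power of the second
  largest, and these two are placed at the two ends.
\<close>


section \<open>Divisor counts and their moments\<close>

definition divisor_count :: "nat \<Rightarrow> nat" where
  "divisor_count m = card {d. d dvd m}"

lemma divisor_count_pos: "m > 0 \<Longrightarrow> divisor_count m > 0"
  unfolding divisor_count_def by (auto simp: card_gt_0_iff)

text \<open>Every divisor of \<open>m * n\<close> is a product of a divisor of \<open>m\<close> and
  a divisor of \<open>n\<close>.\<close>

lemma divisor_count_mult_le:
  assumes "m > 0" "n > 0"
  shows "divisor_count (m * n) \<le> divisor_count m * divisor_count n"
proof -
  have "{d. d dvd m * n} \<subseteq> (\<lambda>(x, y). x * y) ` ({d. d dvd m} \<times> {d. d dvd n})"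
  proof
    fix d assume "d \<in> {d. d dvd m * n}"
    then obtain x y where "d = x * y" "x dvd m" "y dvd n"
      using division_decomp[of d m n] by auto
    then show "d \<in> (\<lambda>(x, y). x * y) ` ({d. d dvd m} \<times> {d. d dvd n})" by force
  qed
  moreover have "finite ({d. d dvd m} \<times> {d. d dvd n})" using assms by auto
  ultimately show ?thesis unfolding divisor_count_def
    using surj_card_le by (fastforce simp flip: card_cartesian_product)
qed

lemma divisor_count_dvd_mono:
  assumes "m dvd n" "n > 0"
  shows "divisor_count m \<le> divisor_count n"
  unfolding divisor_count_def using assms by (intro card_mono) (auto intro: dvd_trans)

lemma divisor_count_prod_le:
  assumes "finite I" "\<And>i. i \<in> I \<Longrightarrow> f i > 0"
  shows "divisor_count (\<Prod>i\<in>I. f i) \<le> (\<Prod>i\<in>I. divisor_count (f i))"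
  using assms
proof (induction I rule: finite_induct)
  case empty
  then show ?case by (simp add: divisor_count_def)
next
  case (insert i I)
  have "divisor_count (\<Prod>j\<in>insert i I. f j) \<le> divisor_count (f i) * divisor_count (\<Prod>j\<in>I. f j)"
    using insert by (auto intro!: divisor_count_mult_le prod_pos)
  also have "\<dots> \<le> divisor_count (f i) * (\<Prod>j\<in>I. divisor_count (f j))"
    using insert by (intro mult_left_mono) auto
  finally show ?case using insert by simp
qed

text \<open>Induction on \<open>C\<close>: one factor \<open>divisor_count q\<close> is written as a
  sum over factorisations q = d e, and submultiplicativity splits the remaining summand between d
  and e. Dropping the constraint d e \<le> N leaves the square of the previous sum, so the exponent
  doubles at each step.\<close>

lemma sum_divisor_count_power_div_le:
  "(\<Sum>q=1..N. real (divisor_count q) ^ C / real q) \<le> (\<Sum>q=1..N. 1 / real q) ^ (2 ^ C)"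
proof (induction C)
  case 0
  then show ?case by simp
next
  case (Suc C)
  let ?f = "\<lambda>q. real (divisor_count q) ^ C / real q"
  let ?S = "SIGMA q:{1..N}. {d. d dvd q}"
  have fin: "finite {d. d dvd q}" if "q \<in> {1..N}" for q using that by auto
  have "(\<Sum>q=1..N. real (divisor_count q) ^ Suc C / real q)
      = (\<Sum>q=1..N. \<Sum>d | d dvd q. ?f q)"
    by (intro sum.cong) (auto simp: divisor_count_def)
  also have "\<dots> = (\<Sum>(q, d)\<in>?S. ?f q)"
    using fin by (subst sum.Sigma) auto
  also have "\<dots> \<le> (\<Sum>(q, d)\<in>?S. ?f d * ?f (q div d))"
  proof (rule sum_mono, clarify)
    fix q d assume qd: "q \<in> {1..N}" "d dvd q"
    then obtain e where e: "q = d * e" by auto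
    with qd have pos: "d > 0" "e > 0" by (auto intro: Nat.gr0I)
    have "real (divisor_count q) ^ C \<le> (real (divisor_count d) * real (divisor_count e)) ^ C"
      using divisor_count_mult_le[OF pos] unfolding e
      by (intro power_mono) (auto simp flip: of_nat_mult)
    then show "?f q \<le> ?f d * ?f (q div d)"
      using pos by (simp add: e field_simps power_mult_distrib)
  qed
  also have "\<dots> = (\<Sum>(d, e)\<in>(\<lambda>(q, d). (d, q div d)) ` ?S. ?f d * ?f e)"
  proof (subst sum.reindex)
    show "inj_on (\<lambda>(q, d). (d, q div d)) ?S"
    proof (rule inj_onI, clarsimp)
      fix a b c :: nat assume "b dvd a" "b dvd c" "a div b = c div b"
      then show "a = c" by (metis dvd_div_mult_self)
    qed
  qed (simp add: case_prod_unfold)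
  also have "\<dots> \<le> (\<Sum>(d, e)\<in>{1..N} \<times> {1..N}. ?f d * ?f e)"
  proof (rule sum_mono2)
    show "(\<lambda>(q, d). (d, q div d)) ` ?S \<subseteq> {1..N} \<times> {1..N}"
    proof clarsimp
      fix q d assume h: "Suc 0 \<le> q" "q \<le> N" "d dvd q"
      then have "d > 0" "q div d > 0" by (auto intro: Nat.gr0I simp: dvd_div_eq_0_iff)
      moreover have "d \<le> q" "q div d \<le> q" using h by (auto intro: dvd_imp_le)
      ultimately show "Suc 0 \<le> d \<and> d \<le> N \<and> Suc 0 \<le> q div d \<and> q div d \<le> N"
        using h by linarith
    qed
  qed auto
  also have "\<dots> = (\<Sum>q=1..N. ?f q) ^ 2"
    by (simp add: power2_eq_square sum_product sum.cartesian_product)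
  also have "\<dots> \<le> ((\<Sum>q=1..N. 1 / real q) ^ (2 ^ C)) ^ 2"
    using Suc by (intro power_mono sum_nonneg) auto
  finally show ?case by (simp add: power_mult [symmetric] mult.commute)
qed

lemma sum_divisor_count_power_div_le_ln:
  assumes "Q \<ge> 1"
  shows "(\<Sum>q=1..nat \<lfloor>Q\<rfloor>. real (divisor_count q) ^ C / real q) \<le> (1 + ln Q) ^ (2 ^ C)"
proof -
  let ?N = "nat \<lfloor>Q\<rfloor>"
  have N: "?N \<ge> 1" "real ?N \<le> Q" using assms by linarith+
  \<comment> \<open>The sequence \<open>harm n - ln n\<close> decreases from its value 1 at n =
    1.\<close>
  have "(\<Sum>q=1..?N. 1 / real q) \<le> 1 + ln (real ?N)"
    using euler_mascheroni_sequence_decreasing[of 1 ?N] N by (simp add: harm_def inverse_eq_divide)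
  also have "\<dots> \<le> 1 + ln Q" using N by simp
  finally have "(\<Sum>q=1..?N. 1 / real q) ^ (2 ^ C) \<le> (1 + ln Q) ^ (2 ^ C)"
    by (intro power_mono sum_nonneg) auto
  then show ?thesis using sum_divisor_count_power_div_le[of C ?N] by linarith
qed

section \<open>Growth of the lcm along a list of denominators\<close>

text \<open>This is w_i of the overview: the factor by which the lcm of the first \<open>i\<close>
  entries grows when entry \<open>i\<close> is added.\<close>

definition fresh_part :: "nat list \<Rightarrow> nat \<Rightarrow> nat" where
  "fresh_part qs i = qs ! i div gcd (qs ! i) (Lcm (set (take i qs)))"

text \<open>This is v_i of the overview: the same growth factor when the list is read from its
  end.\<close>

definition final_part :: "nat list \<Rightarrow> nat \<Rightarrow> nat" where
  "final_part qs i = qs ! i div gcd (qs ! i) (Lcm (set (drop (Suc i) qs)))"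

lemma final_part_rev:
  assumes "i < length qs"
  shows "final_part (rev qs) i = fresh_part qs (length qs - 1 - i)"
  using assms unfolding final_part_def fresh_part_def
  by (simp add: rev_nth drop_rev Suc_diff_Suc)

lemma fresh_part_rev:
  assumes "i < length qs"
  shows "fresh_part (rev qs) i = final_part qs (length qs - 1 - i)"
  using final_part_rev[of "length qs - 1 - i" "rev qs"] assms by simp

lemma lcm_eq_mult_div_gcd: "lcm L (q::nat) = L * (q div gcd q L)"
  by (simp add: lcm_nat_def gcd.commute div_mult_swap)

text \<open>The product telescopes, each factor being the quotient of two consecutive running
  lcms.\<close>

lemma prod_fresh_part: "(\<Prod>i<length qs. fresh_part qs i) = Lcm (set qs)"
proof (induction qs rule: rev_induct)
  case Nil
  then show ?case by simp
next
  case (snoc q qs)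
  have "(\<Prod>i<length qs. fresh_part (qs @ [q]) i) = (\<Prod>i<length qs. fresh_part qs i)"
    by (intro prod.cong) (auto simp: fresh_part_def nth_append)
  moreover have "fresh_part (qs @ [q]) (length qs) = q div gcd q (Lcm (set qs))"
    by (simp add: fresh_part_def)
  ultimately show ?case using snoc
    by (simp add: lcm_eq_mult_div_gcd[symmetric] lcm.commute)
qed

text \<open>Reversal turns final parts into fresh parts and keeps the lcm. The two products
  therefore agree, which is why the weights v_i / w_i of a whole list multiply to 1.\<close>

lemma prod_final_part: "(\<Prod>i<length qs. final_part qs i) = Lcm (set qs)"
proof -
  have "(\<Prod>i<length qs. final_part qs i) = (\<Prod>i<length qs. final_part qs (length qs - 1 - i))"
    using prod.nat_diff_reindex[of "final_part qs" "length qs"] by simp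
  also have "\<dots> = (\<Prod>i<length (rev qs). fresh_part (rev qs) i)"
    by (intro prod.cong) (auto simp: fresh_part_rev)
  also have "\<dots> = Lcm (set (rev qs))" by (rule prod_fresh_part)
  finally show ?thesis by simp
qed

section \<open>Separated points in an interval\<close>

text \<open>Cut the hull of \<open>F\<close>, which lies in \<open>A\<close>, into cells of length
  \<open>c\<close> starting at the minimum of \<open>F\<close>. Each cell holds at most one point,
  so the cell number \<open>h\<close> is injective.\<close>

lemma separated_card_le:
  fixes A :: "real set"
  assumes F: "finite F" "F \<subseteq> A" and A: "is_interval A" "A \<subseteq> {-1..1}" and c: "c > 0"
    and sep: "\<And>x y. x \<in> F \<Longrightarrow> y \<in> F \<Longrightarrow> x \<noteq> y \<Longrightarrow> \<bar>x - y\<bar> \<ge> c"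
  shows "real (card F) \<le> 1 + measure lborel A / c"
proof (cases "F = {}")
  case True
  then show ?thesis using c by simp
next
  case False
  let ?m = "Min F" and ?M = "Max F"
  have mM: "?m \<in> F" "?M \<in> F" "?m \<le> ?M" using F False by auto
  have sub: "{?m..?M} \<subseteq> A" 
    using A(1) mM F(2) unfolding is_interval_1 by (meson atLeastAtMost_iff subsetD subsetI)
  have "A \<in> sets lborel" using A(1) by (simp add: real_interval_borel_measurable)
  \<comment> \<open>Boundedness of \<open>A\<close> enters here: for infinite measure,
    \<open>measure\<close> would take its default value 0.\<close>
  moreover have "emeasure lborel A < \<infinity>"
    using A(2) by (intro emeasure_bounded_finite) (rule bounded_subset[OF bounded_closed_interval])
  ultimately have "measure lborel {?m..?M} \<le> measure lborel A"
    using sub by (intro measure_mono_fmeasurable) (auto simp: fmeasurable_def)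
  then have len: "?M - ?m \<le> measure lborel A" using mM by simp
  define h where "h = (\<lambda>x. \<lfloor>(x - ?m) / c\<rfloor>)"
  have inj: "inj_on h F"
  proof (rule inj_onI)
    fix x y assume xy: "x \<in> F" "y \<in> F" "h x = h y"
    then have "\<bar>(x - ?m) / c - (y - ?m) / c\<bar> < 1" unfolding h_def by linarith
    moreover have "(x - ?m) / c - (y - ?m) / c = (x - y) / c" by (simp add: diff_divide_distrib)
    ultimately have "\<bar>x - y\<bar> < c" using c by (simp add: abs_divide)
    then show "x = y" using sep[OF xy(1,2)] by fastforce
  qed
  have "h ` F \<subseteq> {0..\<lfloor>(?M - ?m) / c\<rfloor>}"
    using F c unfolding h_def by (auto intro!: floor_mono divide_right_mono)
  then have "card F \<le> card {0..\<lfloor>(?M - ?m) / c\<rfloor>}"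
    using inj by (metis card_image card_mono finite_atLeastAtMost_int)
  then have "real (card F) \<le> real (nat (\<lfloor>(?M - ?m) / c\<rfloor> + 1))" by simp
  also have "\<dots> \<le> 1 + (?M - ?m) / c"
  proof -
    have "(?M - ?m) / c \<ge> 0" using mM c by simp
    then show ?thesis by linarith
  qed
  also have "\<dots> \<le> 1 + measure lborel A / c" using len c by (simp add: divide_right_mono)
  finally show ?thesis .
qed


section \<open>Divisibility forced by an integral sum\<close>

lemma dvd_of_fraction_mult_Ints:
  assumes "coprime a (int q)" "q > 0" "real_of_int a / real q * real M \<in> \<int>"
  shows "q dvd M"
proof -
  obtain z where "real_of_int a / real q * real M = of_int z" using assms(3) by (auto elim: Ints_cases)
  then have "real_of_int (a * int M) = real_of_int (z * int q)" using assms(2) by (simp add: field_simps)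
  then have "a * int M = z * int q" by (simp only: of_int_eq_iff)
  then have "int q dvd a * int M" by simp
  then show ?thesis using assms(1) by (simp add: coprime_dvd_mult_right_iff coprime_commute)
qed

lemma mult_Ints_dvd:
  assumes "x * real L \<in> \<int>" "L dvd M"
  shows "x * real M \<in> \<int>"
proof -
  obtain c where "M = L * c" using assms(2) by auto
  then have "x * real M = x * real L * real c" by simp
  then show ?thesis using assms(1) by (metis Ints_mult Ints_of_nat)
qed

text \<open>The fraction is the difference of \<open>s + a / q\<close> and \<open>s\<close>, and
  \<open>lcm L L'\<close> clears both. In the application \<open>L\<close> and \<open>L'\<close> are
  the lcms of the earlier and of the later denominators.\<close>

lemma dvd_lcm_of_sum_Ints:
  assumes "coprime a (int q)" "q > 0" "s * real L \<in> \<int>" "(s + real_of_int a / real q) * real L' \<in> \<int>"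
  shows "q dvd lcm L L'"
proof (rule dvd_of_fraction_mult_Ints[OF assms(1,2)])
  have "s * real (lcm L L') \<in> \<int>" "(s + real_of_int a / real q) * real (lcm L L') \<in> \<int>"
    using assms(3,4) by (auto intro: mult_Ints_dvd)
  then have "(s + real_of_int a / real q) * real (lcm L L') - s * real (lcm L L') \<in> \<int>"
    by (rule Ints_diff[rotated])
  then show "real_of_int a / real q * real (lcm L L') \<in> \<int>" by (simp add: algebra_simps)
qed

text \<open>If \<open>c\<close> divides both quotients, then \<open>q\<close> is divisible by
  \<open>c\<close> times each gcd, hence by \<open>c\<close> times their lcm. By distributivity this
  lcm is \<open>gcd q (lcm L L')\<close>, which is \<open>q\<close> itself, so \<open>c\<close> is a
  unit.\<close>

lemma coprime_div_gcds:
  fixes q L L' :: nat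
  assumes "q > 0" "q dvd lcm L L'"
  shows "coprime (q div gcd q L) (q div gcd q L')"
proof (rule coprimeI)
  fix c assume c: "c dvd q div gcd q L" "c dvd q div gcd q L'"
  have "gcd q L * c dvd q" "gcd q L' * c dvd q"
    using c assms(1) by (metis dvd_mult_div_cancel gcd_dvd1 mult_dvd_mono dvd_refl)+
  then have "lcm (gcd q L * c) (gcd q L' * c) dvd q" by simp
  then have "lcm (gcd q L) (gcd q L') * c dvd q" by (simp add: lcm_mult_right lcm.commute)
  moreover have "lcm (gcd q L) (gcd q L') = q"
    using assms(2) by (simp add: gcd_lcm_distrib [symmetric] gcd_proj1_iff)
  ultimately have "q * c dvd q * 1" by simp
  then show "is_unit c" using assms(1) by (simp only: nat_mult_dvd_cancel1)
qed

text \<open>In the notation of the overview, v divides q = g w and is coprime to w, so it divides g.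
  Hence v, like g, is a divisor of \<open>L\<close>, which limits the number of its values.\<close>

lemma div_gcd_dvd_gcd:
  fixes q L L' :: nat
  assumes "q > 0" "q dvd lcm L L'"
  shows "q div gcd q L' dvd gcd q L"
proof -
  have "q div gcd q L' dvd q" by (metis dvd_mult_div_cancel dvd_triv_right gcd_dvd1)
  then have "q div gcd q L' dvd gcd q L * (q div gcd q L)" by simp
  then show ?thesis using coprime_div_gcds[OF assms]
    by (meson coprime_commute coprime_dvd_mult_left_iff)
qed

text \<open>
  Source of the gain: fractions with the same \<open>g\<close> and \<open>v\<close> that continue the same partial sum are at
  distance at least \<open>v / (g w1 w2)\<close>, which is \<open>v\<close> times the trivial bound.
\<close>

lemma dvd_determinant:
  fixes s :: real
  assumes g: "g > 0" "v dvd g" and w: "w1 > 0" "w2 > 0" and L: "L1 > 0" "L2 > 0"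
    and v: "v = g * w1 div gcd (g * w1) L1" "v = g * w2 div gcd (g * w2) L2"
    and i1: "(s + real_of_int a1 / real (g * w1)) * real L1 \<in> \<int>"
    and i2: "(s + real_of_int a2 / real (g * w2)) * real L2 \<in> \<int>"
  shows "int v dvd a1 * int w2 - a2 * int w1"
proof -
  obtain g' where g': "g = v * g'" using g(2) by auto
  have pos: "v > 0" "g' > 0" using g g' by auto
  \<comment> \<open>As \<open>v\<close> is the quotient of \<open>g * w\<close> by its gcd with
    \<open>M\<close>, that gcd must be \<open>g' * w\<close>, and the cofactor of \<open>M\<close>
    is coprime to the quotient \<open>v\<close>.\<close>
  have split: "\<exists>l. M = g' * w * l \<and> coprime v l" 
    if "w > 0" "M > 0" "v = g * w div gcd (g * w) M" for w M :: nat
  proof (intro exI[of _ "M div gcd (g * w) M"] conjI)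
    have "v * gcd (g * w) M = g * w" by (subst that(3)) simp
    then have "v * gcd (g * w) M = v * (g' * w)" by (simp only: g' mult.assoc)
    then have "gcd (g * w) M = g' * w" using nat_mult_eq_cancel1[OF pos(1)] by blast
    then show "M = g' * w * (M div gcd (g * w) M)" by (metis dvd_mult_div_cancel gcd_dvd2)
    show "coprime v (M div gcd (g * w) M)" using that div_gcd_coprime[of "g * w" M] g by simp
  qed
  obtain l1 where l1: "L1 = g' * w1 * l1" "coprime v l1" using split w L v by blast
  obtain l2 where l2: "L2 = g' * w2 * l2" "coprime v l2" using split w L v by blast
  \<comment> \<open>This multiplier is divisible by both \<open>L1\<close> and \<open>L2\<close>.
    Subtracting the two integers removes \<open>s\<close>, and since \<open>g = v * g'\<close> only
    the denominator \<open>v\<close> survives; \<open>l1\<close> and \<open>l2\<close> are coprime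
    to it.\<close>
  have "(s + real_of_int a1 / real (g * w1)) * real (g' * w1 * w2 * l1 * l2) \<in> \<int>"
    using i1 by (rule mult_Ints_dvd) (auto simp: l1 intro!: dvdI[of _ _ "w2 * l2"])
  moreover have "(s + real_of_int a2 / real (g * w2)) * real (g' * w1 * w2 * l1 * l2) \<in> \<int>"
    using i2 by (rule mult_Ints_dvd) (auto simp: l2 intro!: dvdI[of _ _ "w1 * l1"])
  ultimately have "(s + real_of_int a1 / real (g * w1)) * real (g' * w1 * w2 * l1 * l2)
      - (s + real_of_int a2 / real (g * w2)) * real (g' * w1 * w2 * l1 * l2) \<in> \<int>"
    by (rule Ints_diff)
  also have "(s + real_of_int a1 / real (g * w1)) * real (g' * w1 * w2 * l1 * l2)
      - (s + real_of_int a2 / real (g * w2)) * real (g' * w1 * w2 * l1 * l2)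
      = real_of_int ((a1 * int w2 - a2 * int w1) * int l1 * int l2) / real v"
    using pos w unfolding g' by (simp add: field_simps)
  finally obtain z where "real_of_int ((a1 * int w2 - a2 * int w1) * int l1 * int l2) / real v = of_int z"
    by (auto elim: Ints_cases)
  then have "real_of_int ((a1 * int w2 - a2 * int w1) * int l1 * int l2) = real_of_int (z * int v)"
    using pos by (simp add: field_simps)
  then have "(a1 * int w2 - a2 * int w1) * int l1 * int l2 = z * int v" by (simp only: of_int_eq_iff)
  then have "int v dvd (a1 * int w2 - a2 * int w1) * int l1 * int l2" by simp
  moreover have "coprime (int v) (int l1)" "coprime (int v) (int l2)" using l1 l2 by simp_all
  ultimately show ?thesis by (simp add: coprime_dvd_mult_left_iff)
qed


section \<open>Extending a partial sum by one fraction\<close>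

definition admissible_interval :: "real \<Rightarrow> real set \<Rightarrow> bool" where
  "admissible_interval Q A \<longleftrightarrow>
     Q \<ge> 1 \<and> is_interval A \<and> A \<subseteq> {-1..1} \<and> measure lborel A \<ge> 1 / Q"

text \<open>
  The fractions that may follow a partial sum \<open>s\<close>. Of the fractions still to come only the least
  common multiple \<open>L'\<close> of their denominators matters.
\<close>

definition extension :: "real \<Rightarrow> real \<Rightarrow> real set \<Rightarrow> int \<times> nat \<times> nat \<Rightarrow> bool" where
  "extension s Q A = (\<lambda>(a, q, v). q > 0 \<and> coprime a (int q) \<and> real q \<le> Q \<and>
     real_of_int a / real q \<in> A \<and>
     (\<exists>L'>0. v = q div gcd q L' \<and> (s + real_of_int a / real q) * real L' \<in> \<int>))"

lemma measure_le_2: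
  fixes A :: "real set"
  assumes "A \<subseteq> {-1..1}" "is_interval A"
  shows "measure lborel A \<le> 2"
proof -
  have "A \<in> sets lborel" using assms(2) by (simp add: real_interval_borel_measurable)
  moreover have "{-1..1::real} \<in> fmeasurable lborel" by (simp add: fmeasurable_def)
  ultimately have "measure lborel A \<le> measure lborel {-1..1::real}"
    using assms(1) by (intro measure_mono_fmeasurable)
  then show ?thesis by simp
qed

lemma coprime_fraction_eqD:
  assumes "coprime a (int q)" "coprime b (int r)" "q > 0" "r > 0"
    "real_of_int a / real q = real_of_int b / real r"
  shows "a = b \<and> q = r"
proof -
  have "real_of_int (a * int r) = real_of_int (b * int q)" using assms by (simp add: field_simps)
  then have eq: "a * int r = b * int q" by (simp only: of_int_eq_iff)
  then have "int q dvd a * int r" "int r dvd b * int q" by (metis dvd_triv_right)+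
  then have "q dvd r" "r dvd q" using assms
    by (metis coprime_commute coprime_dvd_mult_right_iff int_dvd_int_iff)+
  then have "q = r" by (rule dvd_antisym)
  then show ?thesis using eq assms by simp
qed

text \<open>Here \<open>k\<close> is a dyadic exponent: w lies in [W, 2W) with W = 2^k, while g and
  v are fixed. By \<open>dvd_determinant\<close> the fractions are v / (4 g W^2)-separated, so there
  are at most 1 + 4 \<delta> g W^2 / v of them, where \<delta> is the length of \<open>A\<close>.
  Each has weight at most v / W, so the total is at most v / W + 4 \<delta> g W, and g W \<le> Q.
  Only the term v / W depends on whether v \<le> w, which is what \<open>\<epsilon>\<close>
  distinguishes.\<close>

lemma sum_extension_class_le:
  fixes E :: "(int \<times> nat \<times> nat) set"
  assumes E: "finite E" "\<And>x. x \<in> E \<Longrightarrow> extension s Q A x" and A: "admissible_interval Q A"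
    and s: "s * real L \<in> \<int>" and L: "L > 0"
    and cls: "\<And>a q u. (a, q, u) \<in> E \<Longrightarrow> gcd q L = g \<and> u = v \<and> floor_log (q div g) = k"
    and \<epsilon>: "\<epsilon> = measure lborel A \<and> (\<forall>(a, q, u)\<in>E. u \<le> q div gcd q L) \<or> \<epsilon> = 1"
  shows "(\<Sum>(a, q, u)\<in>E. real u / real (q div gcd q L)) \<le> 9 * \<epsilon> * Q"
proof (cases "E = {}")
  case True
  then show ?thesis using \<epsilon> A by (auto simp: admissible_interval_def)
next
  case False
  let ?\<delta> = "measure lborel A"
  let ?W = "2 ^ k :: real"
  have Q: "Q \<ge> 1" "?\<delta> \<ge> 1 / Q" "?\<delta> \<le> 2" using A measure_le_2 by (auto simp: admissible_interval_def)
  have facts: "q = g * (q div g) \<and> q div g > 0 \<and> ?W \<le> real (q div g) \<and> real (q div g) < 2 * ?W \<and>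
      v dvd g \<and> g > 0 \<and> v > 0 \<and> v \<le> q \<and> real q \<le> Q" if x: "(a, q, u) \<in> E" for a q u
  proof -
    have q: "q > 0" "coprime a (int q)" "real q \<le> Q" using E(2)[OF x] by (auto simp: extension_def)
    obtain L' where L': "L' > 0" "u = q div gcd q L'" "(s + real_of_int a / real q) * real L' \<in> \<int>"
      using E(2)[OF x] by (auto simp: extension_def)
    have cl: "gcd q L = g" "u = v" "floor_log (q div g) = k" using cls[OF x] by auto
    have "q dvd lcm L L'" using dvd_lcm_of_sum_Ints q s L' by blast
    then have "v dvd g" using div_gcd_dvd_gcd[of q L L'] q L' cl by simp
    moreover have "g > 0" "g dvd q" using cl q by auto
    moreover have "q = g * (q div g)" using \<open>g dvd q\<close> by simp
    moreover have "q div g > 0" using \<open>g dvd q\<close> q by (auto intro: Nat.gr0I simp: dvd_div_eq_0_iff)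
    moreover have "v > 0" using \<open>v dvd g\<close> \<open>g > 0\<close> by (auto intro: Nat.gr0I)
    moreover have "v \<le> q" using \<open>v dvd g\<close> \<open>g dvd q\<close> q by (auto intro: dvd_imp_le dvd_trans)
    moreover have "2 ^ k \<le> q div g" using floor_log_exp2_le[OF \<open>q div g > 0\<close>] cl by simp
    then have "?W \<le> real (q div g)" by (metis of_nat_le_iff of_nat_numeral of_nat_power)
    moreover have "q div g < 2 * 2 ^ k" using floor_log_exp2_gt[of "q div g"] cl by simp
    then have "real (q div g) < 2 * ?W" by (metis of_nat_less_iff of_nat_mult of_nat_numeral of_nat_power)
    ultimately show ?thesis using q by blast
  qed
  obtain a0 q0 u0 where x0: "(a0, q0, u0) \<in> E" using False by (metis ex_in_conv prod_cases3)
  have pos: "g > 0" "v > 0" using facts[OF x0] by auto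
  define c where "c = real v / (real g * (2 * ?W) * (2 * ?W))"
  have c: "c > 0" using pos by (simp add: c_def)
  define r where "r = (\<lambda>(a, q, u :: nat). real_of_int a / real q)"
  have cop: "coprime a (int q) \<and> q > 0" if "(a, q, u) \<in> E" for a q u
    using E(2)[OF that] by (auto simp: extension_def)
  have inj: "inj_on r E"
  proof (rule inj_onI)
    fix x y assume xy: "x \<in> E" "y \<in> E" "r x = r y"
    obtain a q u where x: "x = (a, q, u)" by (cases x)
    obtain a' q' u' where y: "y = (a', q', u')" by (cases y)
    note h = xy[unfolded x y]
    have "a = a' \<and> q = q'" 
      using coprime_fraction_eqD[of a q a' q'] cop[OF h(1)] cop[OF h(2)] h(3) by (simp add: r_def)
    then show "x = y" using cls[OF h(1)] cls[OF h(2)] by (simp add: x y)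
  qed
  have "real (card (r ` E)) \<le> 1 + ?\<delta> / c"
  proof (rule separated_card_le)
    show "r ` E \<subseteq> A" using E(2) by (auto simp: r_def extension_def)
    fix x y assume xy: "x \<in> r ` E" "y \<in> r ` E" "x \<noteq> y"
    obtain a1 q1 u1 where 1: "(a1, q1, u1) \<in> E" "x = real_of_int a1 / real q1" using xy by (auto simp: r_def)
    obtain a2 q2 u2 where 2: "(a2, q2, u2) \<in> E" "y = real_of_int a2 / real q2" using xy by (auto simp: r_def)
    define w1 w2 where w: "w1 = q1 div g" "w2 = q2 div g"
    note f1 = facts[OF 1(1), folded w] and f2 = facts[OF 2(1), folded w]
    obtain L1 where L1: "L1 > 0" "v = q1 div gcd q1 L1" "(s + real_of_int a1 / real q1) * real L1 \<in> \<int>"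
      using E(2)[OF 1(1)] cls[OF 1(1)] by (auto simp: extension_def)
    obtain L2 where L2: "L2 > 0" "v = q2 div gcd q2 L2" "(s + real_of_int a2 / real q2) * real L2 \<in> \<int>"
      using E(2)[OF 2(1)] cls[OF 2(1)] by (auto simp: extension_def)
    have q12: "q1 = g * w1" "q2 = g * w2" using f1 f2 by auto
    define D where "D = a1 * int w2 - a2 * int w1"
    have "int v dvd D" unfolding D_def
      using dvd_determinant[of g v w1 w2 L1 L2 s a1 a2] f1 f2 L1 L2 unfolding q12 by blast
    have xy': "x - y = real_of_int D / (real g * real w1 * real w2)"
      using pos f1 f2 unfolding 1(2) 2(2) q12 D_def by (simp add: field_simps)
    then have "D \<noteq> 0" using xy(3) by auto
    then have "int v \<le> \<bar>D\<bar>" using \<open>int v dvd D\<close> by (metis abs_of_nat dvd_imp_le_int)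
    then have "real v \<le> \<bar>real_of_int D\<bar>" by linarith
    moreover have "real g * real w1 * real w2 \<le> real g * (2 * ?W) * (2 * ?W)"
      using f1 f2 by (intro mult_mono) auto
    ultimately have "c \<le> \<bar>real_of_int D\<bar> / (real g * real w1 * real w2)"
      unfolding c_def using pos f1 f2 by (intro frac_le) auto
    then show "c \<le> \<bar>x - y\<bar>" unfolding xy' by (simp add: abs_mult)
  qed (use E A c in \<open>auto simp: admissible_interval_def\<close>)
  then have card: "real (card E) \<le> 1 + ?\<delta> / c" using inj by (simp add: card_image)
  have "(\<Sum>(a, q, u)\<in>E. real u / real (q div gcd q L)) \<le> (\<Sum>x\<in>E. real v / ?W)"
  proof (rule sum_mono, clarify)
    fix a q u assume "(a, q, u) \<in> E"
    from facts[OF this] cls[OF this] show "real u / real (q div gcd q L) \<le> real v / ?W"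
      by (auto intro!: divide_left_mono)
  qed
  also have "\<dots> \<le> (1 + ?\<delta> / c) * (real v / ?W)" using mult_right_mono[OF card, of "real v / ?W"] by simp
  also have "\<dots> = real v / ?W + 4 * ?\<delta> * (real g * ?W)"
    using pos by (simp add: c_def field_simps)
  also have "\<dots> \<le> real v / ?W + 4 * ?\<delta> * Q"
  proof -
    have "real g * ?W \<le> real g * real (q0 div g)" using facts[OF x0] by (intro mult_left_mono) auto
    also have "\<dots> = real q0" using facts[OF x0] by (metis of_nat_mult)
    also have "\<dots> \<le> Q" using facts[OF x0] by simp
    finally show ?thesis using Q by (intro add_left_mono mult_left_mono) auto
  qed
  \<comment> \<open>The constant 9 comes from the case \<open>\<epsilon> = 1\<close>, where v / W
    \<le> Q and the length of \<open>A\<close> is at most 2. In the other case v / W \<le> 2, and 1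
    is at most the length times \<open>Q\<close>.\<close>
  also have "\<dots> \<le> 9 * \<epsilon> * Q"
    using \<epsilon>
  proof
    assume h: "\<epsilon> = ?\<delta> \<and> (\<forall>(a, q, u)\<in>E. u \<le> q div gcd q L)"
    then have "u0 \<le> q0 div gcd q0 L" using x0 by fastforce
    then have "v \<le> q0 div g" using cls[OF x0] by auto
    then have "real v \<le> 2 * ?W" using facts[OF x0] by linarith
    then have "real v / ?W \<le> 2" by (simp add: field_simps)
    moreover have "1 \<le> ?\<delta> * Q" using Q by (simp add: field_simps)
    moreover have "9 * \<epsilon> * Q = 5 * (?\<delta> * Q) + 4 * ?\<delta> * Q" using h by simp
    ultimately show ?thesis by linarith
  next
    assume h: "\<epsilon> = 1"
    have "real v / ?W \<le> real v / 1" by (intro divide_left_mono) auto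
    also have "\<dots> \<le> Q" using facts[OF x0] by auto
    finally have "real v / ?W \<le> Q" .
    moreover have "?\<delta> * Q \<le> 2 * Q" using Q by (intro mult_right_mono) auto
    ultimately show ?thesis unfolding h by linarith
  qed
  finally show ?thesis .
qed

text \<open>Sort the extensions by g, v and the dyadic size of w. Both g and v divide
  \<open>L\<close>, and w \<le> Q leaves at most \<open>1 + log 2 Q\<close> dyadic ranges; each
  class is covered by \<open>sum_extension_class_le\<close>.\<close>

lemma sum_extension_le:
  fixes E :: "(int \<times> nat \<times> nat) set"
  assumes E: "finite E" "\<And>x. x \<in> E \<Longrightarrow> extension s Q A x" and A: "admissible_interval Q A"
    and s: "s * real L \<in> \<int>" and L: "L > 0"
    and \<epsilon>: "\<epsilon> = measure lborel A \<and> (\<forall>(a, q, u)\<in>E. u \<le> q div gcd q L) \<or> \<epsilon> = 1"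
  shows "(\<Sum>(a, q, u)\<in>E. real u / real (q div gcd q L))
    \<le> real (divisor_count L) ^ 2 * (1 + log 2 Q) * (9 * \<epsilon> * Q)"
proof -
  define h where "h = (\<lambda>(a :: int, q, u :: nat). (gcd q L, u, floor_log (q div gcd q L)))"
  define I where "I = {d. d dvd L} \<times> {d. d dvd L} \<times> {..nat \<lfloor>log 2 Q\<rfloor>}"
  have Q: "Q \<ge> 1" "measure lborel A \<ge> 1 / Q" using A by (auto simp: admissible_interval_def)
  have "\<epsilon> \<ge> 0" using \<epsilon> by auto
  have "finite I" using L by (auto simp: I_def)
  have "h ` E \<subseteq> I"
  proof (rule image_subsetI)
    fix x assume "x \<in> E"
    obtain a q u where xe: "x = (a, q, u)" by (cases x)
    then have x: "(a, q, u) \<in> E" using \<open>x \<in> E\<close> by simp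
    have q: "q > 0" "coprime a (int q)" "real q \<le> Q" using E(2)[OF x] by (auto simp: extension_def)
    obtain L' where L': "L' > 0" "u = q div gcd q L'" "(s + real_of_int a / real q) * real L' \<in> \<int>"
      using E(2)[OF x] by (auto simp: extension_def)
    have "q dvd lcm L L'" using dvd_lcm_of_sum_Ints q s L' by blast
    then have "u dvd gcd q L" using div_gcd_dvd_gcd[of q L L'] q L' by simp
    moreover have "floor_log (q div gcd q L) \<le> nat \<lfloor>log 2 Q\<rfloor>"
    proof -
      have "floor_log (q div gcd q L) \<le> floor_log q" by (simp add: floor_log_le_iff)
      also have "\<dots> = nat \<lfloor>log 2 (real q)\<rfloor>" using q by (simp add: floor_log_altdef)
      also have "\<dots> \<le> nat \<lfloor>log 2 Q\<rfloor>" using q by (intro nat_mono floor_mono) simp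
      finally show ?thesis .
    qed
    ultimately show "h x \<in> I" by (auto simp: xe h_def I_def)
  qed
  then have "(\<Sum>(a, q, u)\<in>E. real u / real (q div gcd q L))
    = (\<Sum>i\<in>I. \<Sum>(a, q, u)\<in>{x \<in> E. h x = i}. real u / real (q div gcd q L))"
    using E(1) \<open>finite I\<close> by (subst sum.group) auto
  also have "\<dots> \<le> (\<Sum>i\<in>I. 9 * \<epsilon> * Q)"
  proof (rule sum_mono)
    fix i assume "i \<in> I"
    obtain g v k where i: "i = (g, v, k)" by (cases i)
    show "(\<Sum>(a, q, u)\<in>{x \<in> E. h x = i}. real u / real (q div gcd q L)) \<le> 9 * \<epsilon> * Q"
    proof (rule sum_extension_class_le[where g = g and v = v and k = k and s = s])
      show "\<epsilon> = measure lborel A \<and> (\<forall>(a, q, u)\<in>{x \<in> E. h x = i}. u \<le> q div gcd q L) \<or> \<epsilon> = 1"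
        using \<epsilon> by blast
    qed (use E A s L in \<open>auto simp: i h_def\<close>)
  qed
  also have "\<dots> = real (divisor_count L) ^ 2 * (real (nat \<lfloor>log 2 Q\<rfloor>) + 1) * (9 * \<epsilon> * Q)"
    by (simp add: I_def card_cartesian_product divisor_count_def power2_eq_square algebra_simps)
  also have "\<dots> \<le> real (divisor_count L) ^ 2 * (1 + log 2 Q) * (9 * \<epsilon> * Q)"
    using Q \<open>\<epsilon> \<ge> 0\<close> by (intro mult_right_mono mult_left_mono) auto
  finally show ?thesis .
qed

section \<open>Weighted sums over prefix trees\<close>

text \<open>The prefixes of \<open>T\<close> form a tree whose nodes carry the weights
  \<open>f\<close>. Summing over the last entry first, with its prefix fixed, peels off one level
  and costs the factor \<open>M n\<close>.\<close>

lemma sum_prefix_tree_le: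
  fixes f :: "'e list \<Rightarrow> real" and M :: "nat \<Rightarrow> real"
  assumes T: "finite T" "\<And>t. t \<in> T \<Longrightarrow> length t \<ge> n" "T \<noteq> {}"
    and f: "\<And>p. f p \<ge> 0"
    and step: "\<And>m p. m < n \<Longrightarrow> p \<in> take m ` T \<Longrightarrow>
      (\<Sum>x | p @ [x] \<in> take (Suc m) ` T. f (p @ [x])) \<le> M m"
  shows "(\<Sum>t\<in>take n ` T. \<Prod>i<n. f (take (Suc i) t)) \<le> (\<Prod>i<n. M i)"
  using T(2) step
proof (induction n)
  case 0
  have "(\<lambda>t. take 0 t) ` T \<subseteq> {[]}" by auto
  then show ?case
    using card_mono[of "{[]}" "take 0 ` T"] by simp
next
  case (Suc n)
  let ?E = "\<lambda>p. {x. p @ [x] \<in> take (Suc n) ` T}"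
  let ?F = "\<lambda>t. \<Prod>i<n. f (take (Suc i) t)"
  have len: "length t \<ge> Suc n" if "t \<in> T" for t using Suc.prems that by blast
  have fin: "finite (?E p)" for p
  proof -
    have "(\<lambda>x. p @ [x]) ` ?E p \<subseteq> take (Suc n) ` T" by auto
    then have "finite ((\<lambda>x. p @ [x]) ` ?E p)" using T(1) finite_subset by blast
    then show ?thesis by (rule finite_imageD) (auto simp: inj_on_def)
  qed
  have eq: "take (Suc n) ` T = (\<lambda>(p, x). p @ [x]) ` (SIGMA p:take n ` T. ?E p)"
  proof (intro equalityI subsetI)
    fix y assume y: "y \<in> take (Suc n) ` T"
    then obtain t where t: "t \<in> T" "y = take (Suc n) t" by blast
    then have "y = take n t @ [t ! n]" using len[of t] by (simp add: take_Suc_conv_app_nth)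
    then show "y \<in> (\<lambda>(p, x). p @ [x]) ` (SIGMA p:take n ` T. ?E p)"
      using y t by (auto intro!: image_eqI[of _ _ "(take n t, t ! n)"])
  qed auto
  have inj: "inj_on (\<lambda>(p, x). p @ [x]) (SIGMA p:take n ` T. ?E p)" by (auto simp: inj_on_def)
  have plen: "length p = n" if "p \<in> take n ` T" for p using that len by fastforce
  have "(\<Sum>t\<in>take (Suc n) ` T. \<Prod>i<Suc n. f (take (Suc i) t))
      = (\<Sum>(p, x)\<in>(SIGMA p:take n ` T. ?E p). \<Prod>i<Suc n. f (take (Suc i) (p @ [x])))"
    using sum.reindex[OF inj, of "\<lambda>t. \<Prod>i<Suc n. f (take (Suc i) t)"]
    unfolding eq[symmetric] by (simp only: case_prod_unfold comp_def)
  also have "\<dots> = (\<Sum>p\<in>take n ` T. \<Sum>x\<in>?E p. \<Prod>i<Suc n. f (take (Suc i) (p @ [x])))"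
    by (rule sum.Sigma[symmetric]) (use T(1) fin in auto)
  also have "\<dots> = (\<Sum>p\<in>take n ` T. ?F p * (\<Sum>x\<in>?E p. f (p @ [x])))"
  proof (rule sum.cong[OF refl])
    fix p assume p: "p \<in> take n ` T"
    have "(\<Prod>i<Suc n. f (take (Suc i) (p @ [x]))) = ?F p * f (p @ [x])" for x
    proof -
      have "(\<Prod>i<n. f (take (Suc i) (p @ [x]))) = ?F p"
        by (rule prod.cong) (auto simp: plen[OF p])
      then show ?thesis by (simp add: plen[OF p])
    qed
    then show "(\<Sum>x\<in>?E p. \<Prod>i<Suc n. f (take (Suc i) (p @ [x]))) = ?F p * (\<Sum>x\<in>?E p. f (p @ [x]))"
      by (simp only: sum_distrib_left)
  qed
  also have "\<dots> \<le> (\<Sum>p\<in>take n ` T. ?F p * M n)"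
    using Suc.prems(2)[of n] by (intro sum_mono mult_left_mono prod_nonneg) (auto simp: f)
  also have "\<dots> = (\<Sum>p\<in>take n ` T. ?F p) * M n" by (simp add: sum_distrib_right)
  also have "\<dots> \<le> (\<Prod>i<n. M i) * M n"
  proof -
    \<comment> \<open>Multiplying the induction hypothesis by \<open>M n\<close> requires
      \<open>M n \<ge> 0\<close>. Any node at depth \<open>n\<close> shows this, since its sum over
      children has nonnegative terms.\<close>
    obtain t where "t \<in> T" using T(3) by auto
    have "0 \<le> (\<Sum>x\<in>?E (take n t). f (take n t @ [x]))" by (intro sum_nonneg f)
    also have "\<dots> \<le> M n" using Suc.prems(2)[of n "take n t"] \<open>t \<in> T\<close> by auto
    finally have "M n \<ge> 0" .
    moreover have "(\<Sum>p\<in>take n ` T. ?F p) \<le> (\<Prod>i<n. M i)"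
    proof (rule Suc.IH)
      show "length t \<ge> n" if "t \<in> T" for t using len[OF that] by simp
    qed (use Suc.prems(2) in auto)
    ultimately show ?thesis by (rule mult_right_mono[rotated])
  qed
  finally show ?case by simp
qed


section \<open>The first fraction\<close>

text \<open>With partial sum 0 the number \<open>L'\<close> clears a / q alone, so q divides
  \<open>L'\<close> and v = 1. Fractions of equal denominator r are 1 / r-separated, which leaves at
  most 1 + \<delta> r \<le> 2 \<delta> Q of them. The remaining sum over r is a moment of the
  divisor count.\<close>

lemma sum_first_extension_le:
  fixes E :: "(int \<times> nat \<times> nat) set"
  assumes E: "finite E" "\<And>x. x \<in> E \<Longrightarrow> extension 0 Q A x" and A: "admissible_interval Q A"
  shows "(\<Sum>(a, q, u)\<in>E. real (divisor_count q) ^ c * real u / real q)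
    \<le> 2 * measure lborel A * Q * (1 + ln Q) ^ (2 ^ c)"
proof -
  let ?\<delta> = "measure lborel A"
  let ?N = "nat \<lfloor>Q\<rfloor>"
  have Q: "Q \<ge> 1" "1 \<le> ?\<delta> * Q" using A by (auto simp: admissible_interval_def field_simps)
  have facts: "q > 0 \<and> coprime a (int q) \<and> q \<le> ?N \<and> real q \<le> Q \<and> real_of_int a / real q \<in> A \<and> u = 1"
    if x: "(a, q, u) \<in> E" for a q u
  proof -
    have q: "q > 0" "coprime a (int q)" "real q \<le> Q" "real_of_int a / real q \<in> A"
      using E(2)[OF x] by (auto simp: extension_def)
    obtain L' where L': "L' > 0" "u = q div gcd q L'" "(0 + real_of_int a / real q) * real L' \<in> \<int>"
      using E(2)[OF x] by (auto simp: extension_def)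
    have "q dvd L'" using dvd_of_fraction_mult_Ints[of a q L'] q L' by simp
    then have "u = 1" using L' q by (simp add: gcd_proj1_if_dvd_nat)
    moreover have "q \<le> ?N" using q(3) by (simp add: le_nat_floor)
    ultimately show ?thesis using q by blast
  qed
  define h where "h = (\<lambda>(a :: int, q :: nat, u :: nat). q)"
  have "h ` E \<subseteq> {1..?N}"
  proof (rule image_subsetI)
    fix x assume "x \<in> E"
    moreover obtain a q u where "x = (a, q, u)" by (cases x)
    ultimately show "h x \<in> {1..?N}" using facts[of a q u] by (simp add: h_def Suc_le_eq)
  qed
  then have "(\<Sum>(a, q, u)\<in>E. real (divisor_count q) ^ c * real u / real q)
      = (\<Sum>r\<in>{1..?N}. \<Sum>(a, q, u)\<in>{x \<in> E. h x = r}. real (divisor_count q) ^ c * real u / real q)"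
    using E(1) by (subst sum.group) auto
  also have "\<dots> \<le> (\<Sum>r\<in>{1..?N}. 2 * ?\<delta> * Q * (real (divisor_count r) ^ c / real r))"
  proof (rule sum_mono)
    fix r assume r: "r \<in> {1..?N}"
    then have "real r \<le> real ?N" by simp
    also have "\<dots> \<le> Q" using Q by linarith
    finally have r0: "r > 0" "real r \<le> Q" using r by auto
    let ?E = "{x \<in> E. h x = r}"
    define b where "b = (\<lambda>(a :: int, q :: nat, u :: nat). real_of_int a / real r)"
    have inj: "inj_on b ?E"
    proof (rule inj_onI)
      fix x y assume xy: "x \<in> ?E" "y \<in> ?E" "b x = b y"
      obtain a q u where x: "x = (a, q, u)" by (cases x)
      obtain a' q' u' where y: "y = (a', q', u')" by (cases y)
      show "x = y" using xy facts[of a q u] facts[of a' q' u'] r0 by (auto simp: x y h_def b_def)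
    qed
    have "real (card (b ` ?E)) \<le> 1 + ?\<delta> / (1 / real r)"
    proof (rule separated_card_le)
      show "b ` ?E \<subseteq> A"
      proof (rule image_subsetI)
        fix x assume "x \<in> ?E"
        moreover obtain a q u where "x = (a, q, u)" by (cases x)
        ultimately show "b x \<in> A" using facts[of a q u] by (auto simp: h_def b_def)
      qed
      fix x y assume xy: "x \<in> b ` ?E" "y \<in> b ` ?E" "x \<noteq> y"
      then obtain a a' :: int where aa: "x = real_of_int a / real r" "y = real_of_int a' / real r"
        by (auto simp: b_def)
      then have "a \<noteq> a'" using xy by auto
      then have "1 \<le> \<bar>real_of_int a - real_of_int a'\<bar>" by linarith
      then show "1 / real r \<le> \<bar>x - y\<bar>"
        unfolding aa diff_divide_distrib[symmetric] abs_divide using r0 by (simp add: divide_right_mono)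
    qed (use E A r0 in \<open>auto simp: admissible_interval_def\<close>)
    then have "real (card ?E) \<le> 1 + ?\<delta> * real r" using inj by (simp add: card_image)
    also have "\<dots> \<le> 2 * ?\<delta> * Q" using mult_left_mono[OF r0(2), of ?\<delta>] Q by simp
    finally have card: "real (card ?E) \<le> 2 * ?\<delta> * Q" .
    have "(\<Sum>(a, q, u)\<in>?E. real (divisor_count q) ^ c * real u / real q)
        = (\<Sum>x\<in>?E. real (divisor_count r) ^ c / real r)"
      using facts by (intro sum.cong) (auto simp: h_def)
    also have "\<dots> = real (card ?E) * (real (divisor_count r) ^ c / real r)" by simp
    also have "\<dots> \<le> 2 * ?\<delta> * Q * (real (divisor_count r) ^ c / real r)"
      using card by (intro mult_right_mono) auto
    finally show "(\<Sum>(a, q, u)\<in>?E. real (divisor_count q) ^ c * real u / real q)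
        \<le> 2 * ?\<delta> * Q * (real (divisor_count r) ^ c / real r)" .
  qed
  also have "\<dots> = 2 * ?\<delta> * Q * (\<Sum>r=1..?N. real (divisor_count r) ^ c / real r)"
    by (simp add: sum_distrib_left)
  also have "\<dots> \<le> 2 * ?\<delta> * Q * (1 + ln Q) ^ (2 ^ c)"
    using Q sum_divisor_count_power_div_le_ln by (intro mult_left_mono) auto
  finally show ?thesis .
qed

section \<open>Counting lists of fractions in a fixed order\<close>

definition fraction :: "int \<times> nat \<Rightarrow> real" where
  "fraction = (\<lambda>(a, q). real_of_int a / real q)"

lemma sum_fractions_mult_Ints:
  assumes "\<forall>x\<in>set t. snd x > 0 \<and> snd x dvd M"
  shows "sum_list (map fraction t) * real M \<in> \<int>"
  using assms
proof (induction t)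
  case Nil
  then show ?case by simp
next
  case (Cons x t)
  obtain c where c: "M = snd x * c" using Cons.prems by auto
  have "fraction x * real M = of_int (fst x * int c)"
    using Cons.prems unfolding c by (auto simp: fraction_def case_prod_unfold)
  then have "fraction x * real M \<in> \<int>" by (metis Ints_of_int)
  then show ?case using Cons by (auto simp: distrib_right)
qed

lemma Lcm_set_pos: "\<forall>x\<in>set xs. x > 0 \<Longrightarrow> Lcm (set xs) > (0 :: nat)"
  by (rule Nat.gr0I) (auto simp: Lcm_0_iff)

lemma divisor_count_Lcm_le:
  assumes "\<forall>x\<in>set xs. x > 0 \<and> divisor_count x \<le> D"
  shows "divisor_count (Lcm (set xs)) \<le> D ^ length xs"
  using assms
proof (induction xs)
  case Nil
  then show ?case by (simp add: divisor_count_def)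
next
  case (Cons x xs)
  have "Lcm (set (x # xs)) dvd x * Lcm (set xs)" by (simp add: lcm_least)
  then have "divisor_count (Lcm (set (x # xs))) \<le> divisor_count (x * Lcm (set xs))"
    using Cons.prems Lcm_set_pos[of xs] by (intro divisor_count_dvd_mono) auto
  also have "\<dots> \<le> divisor_count x * divisor_count (Lcm (set xs))"
    using Cons.prems Lcm_set_pos[of xs] by (intro divisor_count_mult_le) auto
  also have "\<dots> \<le> D * D ^ length xs" using Cons by (intro mult_mono) auto
  finally show ?case by simp
qed

text \<open>\<open>Q\<close> and \<open>A\<close> are indexed by position, starting at 0. The bound
  on divisor counts lets the losses at later positions be charged to the first fraction; the set
  \<open>X\<close> marks positions where v \<le> w, which gain the length of the interval.\<close>

definition good_list :: "nat \<Rightarrow> (nat \<Rightarrow> real) \<Rightarrow> (nat \<Rightarrow> real set) \<Rightarrow> nat set \<Rightarrow> (int \<times> nat) list \<Rightarrow> bool" where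
  "good_list n Q A X t \<longleftrightarrow> length t = n \<and> sum_list (map fraction t) \<in> \<int> \<and>
     (\<forall>i<n. snd (t ! i) > 0 \<and> coprime (fst (t ! i)) (int (snd (t ! i))) \<and>
        real (snd (t ! i)) \<le> Q i \<and> fraction (t ! i) \<in> A i \<and>
        divisor_count (snd (t ! i)) \<le> divisor_count (snd (t ! 0)) ^ n) \<and>
     (\<forall>i\<in>X. final_part (map snd t) i \<le> fresh_part (map snd t) i)"

lemma good_list_pos:
  assumes "good_list n Q A X t"
  shows "\<forall>x\<in>set t. snd x > 0"
proof
  fix x assume "x \<in> set t"
  then obtain i where "i < length t" "x = t ! i" by (auto simp: in_set_conv_nth)
  then show "snd x > 0" using assms by (simp add: good_list_def)
qed

text \<open>
  The final part of a denominator depends on the later denominators, hence it has to be recorded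
  for it to be visible in the prefixes of a list.
\<close>

definition annotate :: "(int \<times> nat) list \<Rightarrow> (int \<times> nat \<times> nat) list" where
  "annotate t = map (\<lambda>i. (fst (t ! i), snd (t ! i), final_part (map snd t) i)) [0..<length t]"

definition strip :: "int \<times> nat \<times> nat \<Rightarrow> int \<times> nat" where
  "strip = (\<lambda>(a, q, v). (a, q))"

lemma map_strip_annotate: "map strip (annotate t) = t"
  by (rule nth_equalityI) (auto simp: annotate_def strip_def)

lemma length_annotate [simp]: "length (annotate t) = length t"
  by (simp add: annotate_def)

text \<open>The ratio v / w for the last fraction of a prefix, with w computed from the denominators
  before it.\<close>

definition prefix_weight :: "(int \<times> nat \<times> nat) list \<Rightarrow> real" where
  "prefix_weight p = (case last p of (a, q, v) \<Rightarrow>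
     real v / real (q div gcd q (Lcm (set (map (snd \<circ> strip) (butlast p))))))"

lemma prefix_weight_annotate:
  assumes "i < length t"
  shows "prefix_weight (take (Suc i) (annotate t)) =
    real (final_part (map snd t) i) / real (fresh_part (map snd t) i)"
proof -
  have "take (Suc i) (annotate t) = take i (annotate t) @ [annotate t ! i]"
    using assms by (simp add: take_Suc_conv_app_nth)
  moreover have "annotate t ! i = (fst (t ! i), snd (t ! i), final_part (map snd t) i)"
    using assms by (simp add: annotate_def)
  moreover have "map (snd \<circ> strip) (take i (annotate t)) = take i (map snd t)"
    by (simp only: map_map[symmetric] take_map[symmetric] map_strip_annotate)
  ultimately show ?thesis using assms by (simp add: prefix_weight_def fresh_part_def)
qed

text \<open>Numerators and denominators both multiply to the lcm of all denominators, so the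
  weighted sum over all lists is a plain count.\<close>

lemma prod_prefix_weight_annotate:
  assumes "\<forall>x\<in>set t. snd x > 0"
  shows "(\<Prod>i<length t. prefix_weight (take (Suc i) (annotate t))) = 1"
proof -
  have "(\<Prod>i<length t. prefix_weight (take (Suc i) (annotate t)))
      = real (\<Prod>i<length (map snd t). final_part (map snd t) i) / real (\<Prod>i<length (map snd t). fresh_part (map snd t) i)"
    by (simp add: prefix_weight_annotate prod_dividef)
  also have "\<dots> = 1"
    unfolding prod_fresh_part prod_final_part
    using Lcm_set_pos[of "map snd t"] assms by auto
  finally show ?thesis .
qed

text \<open>The witness \<open>L'\<close> is the lcm of the later denominators. It clears their sum,
  hence also the integral total minus that sum.\<close>

lemma extension_annotate:
  assumes t: "good_list n Q A X t" and m: "m < n"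
  shows "extension (sum_list (map fraction (map strip (take m (annotate t))))) (Q m) (A m) (annotate t ! m)"
proof -
  have len: "length t = n" using t by (simp add: good_list_def)
  have pos: "\<forall>x\<in>set t. snd x > 0" using t by (rule good_list_pos)
  have nth: "annotate t ! m = (fst (t ! m), snd (t ! m), final_part (map snd t) m)"
    using m len by (simp add: annotate_def)
  have tk: "map strip (take m (annotate t)) = take m t"
    by (simp only: take_map[symmetric] map_strip_annotate)
  let ?s = "sum_list (map fraction (take m t))"
  let ?r = "drop (Suc m) t"
  let ?L = "Lcm (set (map snd ?r))"
  have rpos: "\<forall>x\<in>set ?r. snd x > 0" using pos by (meson in_set_dropD)
  have "t = take m t @ t ! m # ?r" using m len by (simp add: id_take_nth_drop)
  then have "sum_list (map fraction t) = ?s + fraction (t ! m) + sum_list (map fraction ?r)"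
    by (metis (no_types, lifting) append.assoc list.simps(9) map_append sum_list.Cons sum_list.append add.assoc)
  then have "(?s + fraction (t ! m)) * real ?L
      = sum_list (map fraction t) * real ?L - sum_list (map fraction ?r) * real ?L"
    by (simp add: algebra_simps)
  also have "\<dots> \<in> \<int>"
  proof (rule Ints_diff)
    show "sum_list (map fraction t) * real ?L \<in> \<int>" using t by (simp add: good_list_def)
    show "sum_list (map fraction ?r) * real ?L \<in> \<int>"
      using rpos by (intro sum_fractions_mult_Ints) (auto intro: dvd_Lcm)
  qed
  finally have int: "(?s + fraction (t ! m)) * real ?L \<in> \<int>" .
  have "?L > 0" using rpos by (intro Lcm_set_pos) auto
  moreover have "final_part (map snd t) m = snd (t ! m) div gcd (snd (t ! m)) ?L"
    using m len by (simp add: final_part_def drop_map)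
  ultimately show ?thesis
    using int t m unfolding extension_def nth tk good_list_def
    by (auto simp: fraction_def case_prod_unfold intro!: exI[of _ ?L])
qed

text \<open>The cardinality is a weighted sum over the tree of annotated prefixes. The root level is
  bounded by \<open>sum_first_extension_le\<close>, every later level by
  \<open>sum_extension_le\<close>.\<close>

lemma card_good_lists_le:
  assumes T: "finite T" "\<And>t. t \<in> T \<Longrightarrow> good_list n Q A X t" and n: "n > 0"
    and A: "\<And>i. i < n \<Longrightarrow> admissible_interval (Q i) (A i)"
    and X: "X \<subseteq> {..<n}"
    and \<Lambda>: "\<And>i. i < n \<Longrightarrow> 1 + ln (Q i) \<le> \<Lambda>"
  shows "real (card T) \<le> 18 ^ n * \<Lambda> ^ (2 ^ (2 * n\<^sup>2 * (n - 1)) * n) *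
    (\<Prod>i\<in>X. measure lborel (A i)) * (\<Prod>i<n. Q i)"
proof (cases "T = {}")
  case True
  have "ln (Q 0) \<ge> 0" using A[OF n] by (simp add: admissible_interval_def)
  then have "\<Lambda> \<ge> 0" using \<Lambda>[OF n] by linarith
  moreover have "Q i \<ge> 0" if "i < n" for i using A[OF that] by (auto simp: admissible_interval_def)
  ultimately show ?thesis using True by (auto intro!: mult_nonneg_nonneg prod_nonneg)
next
  case False
  \<comment> \<open>With \<open>d\<close> the first divisor count, an lcm of at most
    \<open>n\<close> denominators whose counts are at most \<open>d ^ n\<close> has at most
    \<open>d ^ n\<^sup>2\<close> divisors; the pair (g, v) squares this. The \<open>n - 1\<close>
    later steps together call for the moment of order \<open>N * (n - 1)\<close>, which yields the
    exponent \<open>K\<close>.\<close>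
  define N where "N = 2 * n\<^sup>2"
  define K where "K = (2 ^ (N * (n - 1)) :: nat)"
  define \<epsilon> where "\<epsilon> = (\<lambda>i. if i \<in> X then measure lborel (A i) else 1)"
  define D where "D = (\<lambda>p. real (divisor_count (snd (strip (hd p)))))"
  \<comment> \<open>Each later step loses at most \<open>D ^ N\<close> through the choice of \<open>g\<close> and \<open>v\<close>; this is charged to the
    first fraction, where it costs only a moment of the divisor function.\<close>
  define f where "f = (\<lambda>p. if length p = 1 then prefix_weight p * D p ^ (N * (n - 1))
                            else prefix_weight p / D p ^ N)"
  define U where "U = annotate ` T"
  have U: "finite U" "U \<noteq> {}" using T False by (auto simp: U_def)
  have lenT: "length t = n" if "t \<in> T" for t using T(2)[OF that] by (simp add: good_list_def)
  have lenU: "length u = n" if "u \<in> U" for u using that lenT by (auto simp: U_def)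
  have posT: "\<forall>x\<in>set t. snd x > 0" if "t \<in> T" for t
    using T(2)[OF that] by (rule good_list_pos)
  have "inj_on annotate T" by (metis inj_on_inverseI map_strip_annotate)
  then have cardU: "card U = card T" by (simp add: U_def card_image)
  have takeU: "take n ` U = U" using lenU by (force simp: image_iff)
  have Q1: "Q i \<ge> 1" and \<Lambda>i: "\<Lambda> \<ge> 1 + ln (Q i)" and \<Lambda>1: "\<Lambda> \<ge> 1" if "i < n" for i
  proof -
    show "Q i \<ge> 1" "\<Lambda> \<ge> 1 + ln (Q i)" using A[OF that] \<Lambda>[OF that] by (auto simp: admissible_interval_def)
    moreover have "ln (Q i) \<ge> 0" using \<open>Q i \<ge> 1\<close> by simp
    ultimately show "\<Lambda> \<ge> 1" by linarith
  qed
  \<comment> \<open>All nonempty prefixes of \<open>u\<close> share the first fraction, so the power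
    of \<open>D\<close> at the first position cancels the \<open>n - 1\<close> later
    divisions.\<close>
  have weight: "(\<Prod>i<n. f (take (Suc i) u)) = 1" if u: "u \<in> U" for u
  proof -
    obtain t where t: "t \<in> T" "u = annotate t" using u by (auto simp: U_def)
    have lu: "length u = n" using lenU u by blast
    define d where "d = D u"
    have "hd u \<in> set u" using lu n by (intro hd_in_set) auto
    then have "strip (hd u) \<in> set t" using map_strip_annotate[of t] t by (metis image_eqI list.set_map)
    then have "d > 0" using posT[OF t(1)] by (auto simp: d_def D_def divisor_count_pos)
    have Dt: "D (take (Suc i) u) = d" for i using lu n by (auto simp: D_def d_def)
    obtain n' where n': "n = Suc n'" using n by (cases n) auto
    have "(\<Prod>i<n. f (take (Suc i) u)) =
        f (take 1 u) * (\<Prod>i<n'. f (take (Suc (Suc i)) u))"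
      unfolding n' by (subst prod.lessThan_Suc_shift) simp
    also have "\<dots> = (prefix_weight (take 1 u) * d ^ (N * n')) *
        (\<Prod>i<n'. prefix_weight (take (Suc (Suc i)) u) / d ^ N)"
      using lu n' Dt[of 0] by (simp add: f_def Dt)
    also have "\<dots> = (prefix_weight (take 1 u) * (\<Prod>i<n'. prefix_weight (take (Suc (Suc i)) u)))"
      using \<open>d > 0\<close> by (simp add: prod_dividef power_mult)
    also have "\<dots> = (\<Prod>i<n. prefix_weight (take (Suc i) u))"
      unfolding n' prod.lessThan_Suc_shift by simp
    also have "\<dots> = 1" using prod_prefix_weight_annotate[OF posT[OF t(1)]] lenT[OF t(1)] t by simp
    finally show ?thesis .
  qed
  have "real (card T) = (\<Sum>u\<in>take n ` U. \<Prod>i<n. f (take (Suc i) u))"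
    unfolding takeU using weight by (simp add: cardU)
  \<comment> \<open>The factor 18 is the 9 of \<open>sum_extension_le\<close> times 2 for passing
    from \<open>log 2\<close> to \<open>ln\<close>.\<close>
  also have "\<dots> \<le> (\<Prod>i<n. 18 * \<Lambda> ^ K * \<epsilon> i * Q i)"
  proof (rule sum_prefix_tree_le)
    show "f p \<ge> 0" for p by (auto simp: f_def prefix_weight_def D_def split: prod.split)
    fix m p assume m: "m < n" and p: "p \<in> take m ` U"
    let ?E = "{x. p @ [x] \<in> take (Suc m) ` U}"
    let ?s = "sum_list (map fraction (map strip p))"
    let ?L = "Lcm (set (map (snd \<circ> strip) p))"
    have lp: "length p = m" using p m lenU by fastforce
    have from_T: "\<exists>t\<in>T. p = take m (annotate t) \<and> x = annotate t ! m" if "x \<in> ?E" for x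
    proof -
      obtain t where t: "t \<in> T" "p @ [x] = take (Suc m) (annotate t)" using \<open>x \<in> ?E\<close> by (auto simp: U_def)
      moreover have "take (Suc m) (annotate t) = take m (annotate t) @ [annotate t ! m]"
        using m lenT[OF t(1)] by (simp add: take_Suc_conv_app_nth)
      ultimately show ?thesis by auto
    qed
    have fin: "finite ?E"
    proof (rule finite_subset)
      show "?E \<subseteq> (\<lambda>u. u ! m) ` U" using from_T by (fastforce simp: U_def)
    qed (use U in auto)
    have ext: "extension ?s (Q m) (A m) x" if "x \<in> ?E" for x
      using from_T[OF that] extension_annotate[OF T(2) m] by auto
    have pw: "prefix_weight (p @ [(a, q, v)]) = real v / real (q div gcd q ?L)" for a q v
      by (simp add: prefix_weight_def)
    have \<epsilon>0: "\<epsilon> m \<ge> 0" "measure lborel (A m) \<le> 2 * \<epsilon> m"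
      using measure_le_2[of "A m"] A[OF m] by (auto simp: \<epsilon>_def admissible_interval_def)
    have K: "K \<ge> 1" by (simp add: K_def)
    show "(\<Sum>x\<in>?E. f (p @ [x])) \<le> 18 * \<Lambda> ^ K * \<epsilon> m * Q m"
    proof (cases "m = 0")
      case True
      then have p0: "p = []" using lp by simp
      have "(\<Sum>x\<in>?E. f (p @ [x])) =
          (\<Sum>(a, q, u)\<in>?E. real (divisor_count q) ^ (N * (n - 1)) * real u / real q)"
        unfolding p0 by (intro sum.cong) (auto simp: f_def D_def prefix_weight_def strip_def)
      also have "\<dots> \<le> 2 * measure lborel (A m) * Q m * (1 + ln (Q m)) ^ K"
        unfolding K_def using fin ext A[OF m] by (intro sum_first_extension_le) (auto simp: p0)
      \<comment> \<open>The first position always gains the length; if it lies outside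
        \<open>X\<close>, the length is simply bounded by 2.\<close>
      also have "\<dots> \<le> 2 * (2 * \<epsilon> m) * Q m * \<Lambda> ^ K"
        using \<epsilon>0 Q1[OF m] \<Lambda>i[OF m] by (intro mult_mono power_mono) auto
      also have "\<dots> \<le> 18 * \<Lambda> ^ K * \<epsilon> m * Q m"
        using mult_nonneg_nonneg[of "\<Lambda> ^ K" "\<epsilon> m * Q m"] \<epsilon>0 Q1[OF m] \<Lambda>1[OF m] by simp
      finally show ?thesis .
    next
      case False
      obtain t0 where t0: "t0 \<in> T" "p = take m (annotate t0)" using p by (auto simp: U_def)
      have mp: "map strip p = take m t0"
        unfolding t0(2) by (simp only: take_map[symmetric] map_strip_annotate)
      then have mp2: "map (snd \<circ> strip) p = map snd (take m t0)" by (metis map_map)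
      have ppos: "\<forall>x\<in>set (map strip p). snd x > 0"
        unfolding mp using posT[OF t0(1)] by (meson in_set_takeD)
      have Lpos: "?L > 0" using ppos by (intro Lcm_set_pos) auto
      have sL: "?s * real ?L \<in> \<int>"
        using ppos by (intro sum_fractions_mult_Ints) (auto intro: dvd_Lcm)
      define d where "d = divisor_count (snd (t0 ! 0))"
      have "snd (t0 ! 0) > 0" using T(2)[OF t0(1)] n by (auto simp: good_list_def)
      then have d: "d > 0" by (simp add: d_def divisor_count_pos)
      have "divisor_count ?L \<le> (d ^ n) ^ length (map snd (take m t0))"
        unfolding mp2
      proof (rule divisor_count_Lcm_le, rule ballI)
        fix x assume "x \<in> set (map snd (take m t0))"
        then obtain i where "i < m" "x = snd (t0 ! i)" using lenT[OF t0(1)] m by (auto simp: in_set_conv_nth)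
        then show "x > 0 \<and> divisor_count x \<le> d ^ n"
          using T(2)[OF t0(1)] m by (auto simp: good_list_def d_def)
      qed
      also have "\<dots> \<le> (d ^ n) ^ n" using d m lenT[OF t0(1)] by (intro power_increasing) auto
      also have "\<dots> = d ^ n\<^sup>2" by (simp add: power_mult[symmetric] power2_eq_square)
      finally have "divisor_count ?L \<le> d ^ n\<^sup>2" .
      then have "divisor_count ?L ^ 2 \<le> (d ^ n\<^sup>2) ^ 2" by (rule power_mono) simp
      also have "\<dots> = d ^ N" by (simp add: N_def power_mult[symmetric] mult.commute)
      finally have tau: "real (divisor_count ?L) ^ 2 \<le> real d ^ N" by (metis of_nat_le_iff of_nat_power)
      have hd: "D (p @ [x]) = real d" for x
      proof -
        have "p \<noteq> []" using lp False by auto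
        then have "strip (hd (p @ [x])) = hd (map strip p)" by (simp add: hd_map)
        also have "\<dots> = t0 ! 0" unfolding mp using False lenT[OF t0(1)] n by (cases t0) auto
        finally show ?thesis by (simp add: D_def d_def)
      qed
      have "(\<Sum>x\<in>?E. f (p @ [x])) = (\<Sum>(a, q, u)\<in>?E. real u / real (q div gcd q ?L)) / real d ^ N"
        unfolding sum_divide_distrib
      proof (rule sum.cong[OF refl])
        fix x :: "int \<times> nat \<times> nat"
        obtain a q u where x: "x = (a, q, u)" by (cases x)
        have "length (p @ [x]) \<noteq> 1" using lp False by simp
        then show "f (p @ [x]) = (case x of (a, q, u) \<Rightarrow> real u / real (q div gcd q ?L)) / real d ^ N"
          unfolding f_def hd unfolding x pw by simp
      qed
      also have "\<dots> \<le> (real (divisor_count ?L) ^ 2 * (1 + log 2 (Q m)) * (9 * \<epsilon> m * Q m)) / real d ^ N"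
      proof (rule divide_right_mono)
        show "(\<Sum>(a, q, u)\<in>?E. real u / real (q div gcd q ?L))
          \<le> real (divisor_count ?L) ^ 2 * (1 + log 2 (Q m)) * (9 * \<epsilon> m * Q m)"
        proof (rule sum_extension_le[OF fin ext A[OF m] sL Lpos])
          show "\<epsilon> m = measure lborel (A m) \<and> (\<forall>(a, q, u)\<in>?E. u \<le> q div gcd q ?L) \<or> \<epsilon> m = 1"
          proof (cases "m \<in> X")
            case True
            \<comment> \<open>Any list of \<open>T\<close> through this node yields the inequality:
              \<open>p\<close> and \<open>q\<close> determine the fresh part, and \<open>u\<close>
              records the final part.\<close>
            have "u \<le> q div gcd q ?L" if x: "(a, q, u) \<in> ?E" for a q u
            proof -
              obtain t where t: "t \<in> T" "p = take m (annotate t)" "(a, q, u) = annotate t ! m"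
                using from_T[OF x] by auto
              have "map strip p = take m t"
                unfolding t(2) by (simp only: take_map[symmetric] map_strip_annotate)
              then have "map (snd \<circ> strip) p = take m (map snd t)" by (metis map_map take_map)
              moreover have "q = snd (t ! m)" "u = final_part (map snd t) m"
                using t(3) m lenT[OF t(1)] by (auto simp: annotate_def)
              moreover have "final_part (map snd t) m \<le> fresh_part (map snd t) m"
                using T(2)[OF t(1)] True by (simp add: good_list_def)
              ultimately show ?thesis using m lenT[OF t(1)] by (simp add: fresh_part_def)
            qed
            then show ?thesis using True by (auto simp: \<epsilon>_def)
          qed (simp add: \<epsilon>_def)
        qed
      qed simp
      also have "\<dots> \<le> (real d ^ N * (2 * \<Lambda> ^ K) * (9 * \<epsilon> m * Q m)) / real d ^ N"
      proof (intro divide_right_mono mult_right_mono mult_mono)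
        have "log 2 (Q m) \<le> 2 * ln (Q m)"
        proof -
          have "ln (2 :: real) \<ge> 1 / 2" using ln2_ge_two_thirds by simp
          then have "ln (Q m) / ln 2 \<le> ln (Q m) / (1 / 2)"
            using Q1[OF m] by (intro divide_left_mono) auto
          then show ?thesis by (simp add: log_def)
        qed
        then have "1 + log 2 (Q m) \<le> 2 * \<Lambda> ^ 1" using \<Lambda>i[OF m] by simp
        also have "\<dots> \<le> 2 * \<Lambda> ^ K" using K \<Lambda>1[OF m] by (intro mult_left_mono power_increasing) auto
        finally show "1 + log 2 (Q m) \<le> 2 * \<Lambda> ^ K" .
        show "1 + log 2 (Q m) \<ge> 0" using Q1[OF m] by simp
      qed (use tau \<epsilon>0 Q1[OF m] in auto)
      also have "\<dots> = 18 * \<Lambda> ^ K * \<epsilon> m * Q m" using d by simp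
      finally show ?thesis .
    qed
  qed (use U lenU in auto)
  also have "\<dots> = 18 ^ n * \<Lambda> ^ (K * n) * (\<Prod>i<n. \<epsilon> i) * (\<Prod>i<n. Q i)"
    by (simp add: prod.distrib power_mult)
  also have "(\<Prod>i<n. \<epsilon> i) = (\<Prod>i\<in>X. measure lborel (A i))"
    using X by (simp add: \<epsilon>_def prod.If_cases Int_absorb1)
  finally show ?thesis by (simp add: K_def N_def)
qed


section \<open>Choosing the order of the indices\<close>

lemma ex_max_of_finite:
  fixes f :: "'a \<Rightarrow> 'b :: linorder"
  assumes "finite S" "S \<noteq> {}"
  shows "\<exists>j\<in>S. \<forall>i\<in>S. f i \<le> f j"
proof -
  have "Max (f ` S) \<in> f ` S" using assms by simp
  then obtain j where "j \<in> S" "f j = Max (f ` S)" by auto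
  moreover from this have "f i \<le> f j" if "i \<in> S" for i using assms that by simp
  ultimately show ?thesis by blast
qed

definition tuple_list :: "(nat \<Rightarrow> int) \<times> (nat \<Rightarrow> int) \<Rightarrow> nat list \<Rightarrow> (int \<times> nat) list" where
  "tuple_list x \<sigma> = map (\<lambda>i. (fst x i, nat (snd x i))) \<sigma>"

text \<open>The product of the other denominators clears the other fractions and the integral total,
  hence also the reduced fraction at \<open>j\<close>.\<close>

lemma denominator_dvd_prod_others:
  fixes a :: "nat \<Rightarrow> int" and m :: "nat \<Rightarrow> nat"
  assumes S: "finite S" "j \<in> S" and m: "\<And>i. i \<in> S \<Longrightarrow> m i > 0"
    and "coprime (a j) (int (m j))" and int: "(\<Sum>i\<in>S. real_of_int (a i) / real (m i)) \<in> \<int>"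
  shows "m j dvd (\<Prod>i\<in>S - {j}. m i)"
proof (rule dvd_of_fraction_mult_Ints[of "a j"])
  let ?M = "\<Prod>i\<in>S - {j}. m i"
  have "real_of_int (a i) / real (m i) * real ?M \<in> \<int>" if "i \<in> S - {j}" for i
  proof -
    have "m i dvd ?M" using S that by (intro dvd_prodI) auto
    moreover have "real_of_int (a i) / real (m i) * real (m i) \<in> \<int>" using m that by simp
    ultimately show ?thesis by (rule mult_Ints_dvd[rotated])
  qed
  then have "(\<Sum>i\<in>S - {j}. real_of_int (a i) / real (m i) * real ?M) \<in> \<int>" by (rule Ints_sum)
  moreover have "(\<Sum>i\<in>S. real_of_int (a i) / real (m i)) * real ?M \<in> \<int>"
    using int Ints_of_nat by (rule Ints_mult)
  ultimately have "(\<Sum>i\<in>S. real_of_int (a i) / real (m i)) * real ?M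
      - (\<Sum>i\<in>S - {j}. real_of_int (a i) / real (m i) * real ?M) \<in> \<int>"
    by (rule Ints_diff[rotated])
  moreover have "(\<Sum>i\<in>S. real_of_int (a i) / real (m i)) * real ?M
      - (\<Sum>i\<in>S - {j}. real_of_int (a i) / real (m i) * real ?M) = real_of_int (a j) / real (m j) * real ?M"
    unfolding sum.remove[OF S] sum_distrib_right[symmetric] by (simp only: distrib_right add_diff_cancel_right')
  ultimately show "real_of_int (a j) / real (m j) * real ?M \<in> \<int>" by simp
qed (use assms in auto)

lemma exists_good_ordering:
  assumes k: "k \<ge> 1" and x: "(a, q) \<in> integral_fraction_tuples (2 * k + 1) Q A"
  shows "\<exists>\<sigma> X. distinct \<sigma> \<and> set \<sigma> = {1..2 * k + 1} \<and> X \<subseteq> {..<2 * k + 1} \<and> card X = k + 1 \<and>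
    good_list (2 * k + 1) (\<lambda>i. Q (\<sigma> ! i)) (\<lambda>i. A (\<sigma> ! i)) X (tuple_list (a, q) \<sigma>)"
proof -
  define n where "n = 2 * k + 1"
  define S where "S = {1..n}"
  define m where "m = (\<lambda>i. nat (q i))"
  define \<tau> where "\<tau> = (\<lambda>i. divisor_count (m i))"
  have fS: "finite S" "card S = n" by (simp_all add: S_def)
  have tup: "m i > 0 \<and> real (m i) = real_of_int (q i) \<and> coprime (a i) (int (m i)) \<and> real (m i) \<le> Q i \<and>
      real_of_int (a i) / real (m i) \<in> A i" if "i \<in> S" for i
  proof -
    have qi: "1 \<le> q i" "real_of_int (q i) \<le> Q i" "coprime (a i) (q i)"
        "real_of_int (a i) / real_of_int (q i) \<in> A i"
      using x that by (auto simp: integral_fraction_tuples_def S_def n_def)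
    then have m: "int (m i) = q i" by (simp add: m_def)
    then have "real (m i) = real_of_int (q i)" by (metis of_int_of_nat_eq)
    moreover have "m i > 0" using m qi(1) by linarith
    ultimately show ?thesis using qi m by metis
  qed
  have int: "(\<Sum>i\<in>S. real_of_int (a i) / real (m i)) \<in> \<int>"
  proof -
    have "(\<Sum>i\<in>S. real_of_int (a i) / real (m i)) = (\<Sum>i\<in>S. real_of_int (a i) / real_of_int (q i))"
      using tup by (intro sum.cong refl) simp
    then show ?thesis using x by (simp add: integral_fraction_tuples_def S_def n_def)
  qed
  have \<tau>1: "\<tau> i \<ge> 1" if "i \<in> S" for i using tup[OF that] divisor_count_pos[of "m i"] by (simp add: \<tau>_def Suc_le_eq)
  obtain j where j: "j \<in> S" "\<forall>i\<in>S. \<tau> i \<le> \<tau> j"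
    using ex_max_of_finite[of S \<tau>] by (auto simp: S_def n_def)
  have cj: "card (S - {j}) = n - 1" using fS j by simp
  then have "card (S - {j}) \<noteq> 0" using k by (simp add: n_def)
  then have ne: "S - {j} \<noteq> {}" by (metis card.empty)
  then obtain j' where j': "j' \<in> S - {j}" "\<forall>i\<in>S - {j}. \<tau> i \<le> \<tau> j'"
    using ex_max_of_finite[of "S - {j}" \<tau>, OF _ ne] fS(1) by auto
  \<comment> \<open>The largest count is at most the product of the \<open>n - 1\<close> others,
    each at most \<open>\<tau> j'\<close>. The exponent is rounded up to \<open>n\<close> to fit
    \<open>good_list\<close>.\<close>
  have "\<tau> j \<le> divisor_count (\<Prod>i\<in>S - {j}. m i)"
    unfolding \<tau>_def
  proof (rule divisor_count_dvd_mono)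
    show "m j dvd (\<Prod>i\<in>S - {j}. m i)"
      using denominator_dvd_prod_others[OF fS(1) j(1) _ _ int] tup j(1) by blast
    show "(\<Prod>i\<in>S - {j}. m i) > 0" using tup by (intro prod_pos) blast
  qed
  also have "\<dots> \<le> (\<Prod>i\<in>S - {j}. \<tau> i)"
    unfolding \<tau>_def using fS tup by (intro divisor_count_prod_le) auto
  also have "\<dots> \<le> (\<Prod>i\<in>S - {j}. \<tau> j')" using j' by (intro prod_mono) auto
  also have "\<dots> = \<tau> j' ^ (n - 1)" by (simp add: cj)
  also have "\<dots> \<le> \<tau> j' ^ n" using \<tau>1 j' by (intro power_increasing) auto
  finally have jj': "\<tau> j \<le> \<tau> j' ^ n" .
  have first: "\<tau> i \<le> \<tau> h ^ n" if "i \<in> S" "h \<in> {j, j'}" for i h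
  proof (cases "h = j")
    case True
    have "\<tau> i \<le> \<tau> j" using j that by blast
    also have "\<dots> \<le> \<tau> j ^ n" using \<tau>1 j by (intro self_le_power) (auto simp: n_def)
    finally show ?thesis using True by simp
  next
    case False
    then have "h = j'" using that by simp
    then show ?thesis using j that jj' by force
  qed
  have good: "good_list n (\<lambda>i. Q (\<sigma> ! i)) (\<lambda>i. A (\<sigma> ! i)) X (tuple_list (a, q) \<sigma>)"
    if \<sigma>: "distinct \<sigma>" "set \<sigma> = S" "\<sigma> ! 0 \<in> {j, j'}"
      and X: "X \<subseteq> {i. i < n \<and> final_part (map m \<sigma>) i \<le> fresh_part (map m \<sigma>) i}" for \<sigma> X
  proof -
    have len: "length \<sigma> = n" using \<sigma> fS distinct_card by fastforce
    have snd: "map snd (tuple_list (a, q) \<sigma>) = map m \<sigma>" by (simp add: tuple_list_def m_def)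
    have sum: "sum_list (map fraction (tuple_list (a, q) \<sigma>)) = (\<Sum>i\<in>S. real_of_int (a i) / real (m i))"
      using \<sigma> by (simp add: tuple_list_def m_def fraction_def comp_def sum.distinct_set_conv_list[symmetric])
    let ?l = "tuple_list (a, q) \<sigma>"
    have mem: "\<sigma> ! i \<in> S" if "i < n" for i using \<sigma> len that nth_mem by blast
    have nth: "?l ! i = (a (\<sigma> ! i), m (\<sigma> ! i))" if "i < n" for i
      using len that by (simp add: tuple_list_def m_def)
    have "snd (?l ! i) > 0 \<and> coprime (fst (?l ! i)) (int (snd (?l ! i))) \<and>
        real (snd (?l ! i)) \<le> Q (\<sigma> ! i) \<and> fraction (?l ! i) \<in> A (\<sigma> ! i) \<and>
        divisor_count (snd (?l ! i)) \<le> divisor_count (snd (?l ! 0)) ^ n" if i: "i < n" for i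
    proof -
      have "?l ! 0 = (a (\<sigma> ! 0), m (\<sigma> ! 0))" by (rule nth) (simp add: n_def)
      then show ?thesis
        using tup[OF mem[OF i]] first[OF mem[OF i] \<sigma>(3)] unfolding nth[OF i] \<tau>_def
        by (auto simp: fraction_def)
    qed
    then show ?thesis
      unfolding good_list_def snd sum using int X by (auto simp: len tuple_list_def)
  qed
  \<comment> \<open>The two largest divisor counts go to both ends, so that \<open>\<sigma>\<close> and its reverse are both suitable.\<close>
  define \<sigma> where "\<sigma> = j # sorted_list_of_set (S - {j, j'}) @ [j']"
  have \<sigma>: "distinct \<sigma>" "set \<sigma> = S" using fS j j' by (auto simp: \<sigma>_def)
  have len: "length \<sigma> = n" using \<sigma> fS distinct_card by fastforce
  define Y where "Y = (\<lambda>\<sigma>. {i. i < n \<and> final_part (map m \<sigma>) i \<le> fresh_part (map m \<sigma>) i})"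
  have fY: "finite (Y \<sigma>)" for \<sigma> by (simp add: Y_def)
  \<comment> \<open>Reversal exchanges fresh and final parts and sends position \<open>i\<close> to
    \<open>n - 1 - i\<close>. So every position is favourable in one of the two orders, and since
    \<open>n = 2 * k + 1\<close> one order has at least \<open>k + 1\<close> favourable
    positions.\<close>
  have "{..<n} \<subseteq> Y \<sigma> \<union> (\<lambda>i. n - 1 - i) ` Y (rev \<sigma>)"
  proof
    fix i assume "i \<in> {..<n}"
    then have i: "i < n" by simp
    show "i \<in> Y \<sigma> \<union> (\<lambda>i. n - 1 - i) ` Y (rev \<sigma>)"
    proof (cases "i \<in> Y \<sigma>")
      case False
      then have "fresh_part (map m \<sigma>) i \<le> final_part (map m \<sigma>) i" using i by (simp add: Y_def)
      then have "n - 1 - i \<in> Y (rev \<sigma>)"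
        using i len by (simp add: Y_def rev_map[symmetric] final_part_rev fresh_part_rev)
      moreover have "i = n - 1 - (n - 1 - i)" using i by simp
      ultimately show ?thesis by blast
    qed simp
  qed
  then have "n \<le> card (Y \<sigma> \<union> (\<lambda>i. n - 1 - i) ` Y (rev \<sigma>))"
    using card_mono[of "Y \<sigma> \<union> (\<lambda>i. n - 1 - i) ` Y (rev \<sigma>)" "{..<n}"] fY by simp
  also have "\<dots> \<le> card (Y \<sigma>) + card (Y (rev \<sigma>))"
    using card_Un_le[of "Y \<sigma>" "(\<lambda>i. n - 1 - i) ` Y (rev \<sigma>)"] card_image_le[OF fY, of "\<lambda>i. n - 1 - i" "rev \<sigma>"] by linarith
  finally have "k + 1 \<le> card (Y \<sigma>) \<or> k + 1 \<le> card (Y (rev \<sigma>))" unfolding n_def by linarith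
  then obtain \<rho> where \<rho>: "\<rho> \<in> {\<sigma>, rev \<sigma>}" "k + 1 \<le> card (Y \<rho>)" by blast
  then obtain X where X: "X \<subseteq> Y \<rho>" "card X = k + 1" using obtain_subset_with_card_n by metis
  have "\<sigma> ! 0 = j" "rev \<sigma> ! 0 = j'" by (simp_all add: \<sigma>_def)
  then have "distinct \<rho>" "set \<rho> = S" "\<rho> ! 0 \<in> {j, j'}" using \<rho>(1) \<sigma> by auto
  moreover from this have "good_list n (\<lambda>i. Q (\<rho> ! i)) (\<lambda>i. A (\<rho> ! i)) X (tuple_list (a, q) \<rho>)"
    using X by (intro good) (auto simp: Y_def)
  moreover have "X \<subseteq> {..<n}" using X by (auto simp: Y_def)
  ultimately show ?thesis using X(2) unfolding n_def S_def by blast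
qed

section \<open>Summing over all orders and index sets\<close>

theorem theorem2p1:
  fixes k :: nat
  assumes "k \<ge> 1"
  shows "\<exists>(C::real) (K::nat). \<forall>(Q :: nat \<Rightarrow> real) (A :: nat \<Rightarrow> real set) (\<delta> :: nat \<Rightarrow> real).
    (\<forall>i\<in>{1..2*k+1}. Q i \<ge> 1 \<and> is_interval (A i) \<and> A i \<subseteq> {-1..1} \<and>
        measure lborel (A i) = \<delta> i \<and> \<delta> i \<ge> 1 / Q i) \<longrightarrow>
    (\<exists>X\<subseteq>{1..2*k+1}. card X = k + 1 \<and>
      (\<exists>e\<le>K. real (card (integral_fraction_tuples (2*k+1) Q A))
         \<le> C * ln (\<Prod>i=1..2*k+1. Q i) ^ e * (\<Prod>i\<in>X. \<delta> i) * (\<Prod>i=1..2*k+1. Q i)))"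
proof -
  define n where "n = 2 * k + 1"
  define K where "K = 2 ^ (2 * n\<^sup>2 * (n - 1)) * n"
  define I where "I = {\<sigma>. distinct \<sigma> \<and> set \<sigma> = {1..n}} \<times> {X. X \<subseteq> {..<n} \<and> card X = k + 1}"
  define C where "C = real (card I) * 18 ^ n * 2 ^ K"
  have "{\<sigma>. distinct \<sigma> \<and> set \<sigma> = {1..n}} \<subseteq> {\<sigma>. set \<sigma> \<subseteq> {1..n} \<and> length \<sigma> \<le> n}"
    using distinct_card by fastforce
  moreover have "finite {\<sigma>. set \<sigma> \<subseteq> {1..n} \<and> length \<sigma> \<le> n}" by (intro finite_lists_length_le) simp
  ultimately have "finite {\<sigma>. distinct \<sigma> \<and> set \<sigma> = {1..n}}" by (rule finite_subset)
  moreover have "finite {X. X \<subseteq> {..<n} \<and> card X = k + 1}"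
    by (rule finite_subset[of _ "Pow {..<n}"]) auto
  ultimately have finI: "finite I" unfolding I_def by (rule finite_cartesian_product)
  show ?thesis
  proof (intro exI[of _ C] exI[of _ K] allI impI)
    fix Q :: "nat \<Rightarrow> real" and A :: "nat \<Rightarrow> real set" and \<delta> :: "nat \<Rightarrow> real"
    assume "\<forall>i\<in>{1..2*k+1}. Q i \<ge> 1 \<and> is_interval (A i) \<and> A i \<subseteq> {-1..1} \<and>
        measure lborel (A i) = \<delta> i \<and> \<delta> i \<ge> 1 / Q i"
    then have h: "Q i \<ge> 1" "is_interval (A i)" "A i \<subseteq> {-1..1}" "measure lborel (A i) = \<delta> i" "\<delta> i \<ge> 1 / Q i"
      if "i \<in> {1..n}" for i using that by (auto simp: n_def)
    define F where "F = integral_fraction_tuples n Q A"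
    define P where "P = (\<Prod>i=1..n. Q i)"
    define \<Lambda> where "\<Lambda> = 1 + ln P"
    have finF: "finite F" unfolding F_def using h by (intro finite_integral_fraction_tuples) auto
    have \<delta>0: "\<delta> i \<ge> 0" if "i \<in> {1..n}" for i
      using h(4)[OF that] measure_nonneg[of lborel "A i"] by simp
    have QP: "Q i \<le> P" if "i \<in> {1..n}" for i
    proof -
      have "Q i * 1 \<le> Q i * (\<Prod>i\<in>{1..n} - {i}. Q i)"
        using h(1) that by (intro mult_left_mono prod_ge_1) (auto intro: order_trans[OF zero_le_one])
      then show ?thesis using that by (simp add: P_def prod.remove[of _ i])
    qed
    have P1: "P \<ge> 1" unfolding P_def using h(1) by (intro prod_ge_1) auto
    \<comment> \<open>A single \<open>X\<close> must serve all tuples, although the indices that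
      gain vary from tuple to tuple. A subset with the largest product of lengths dominates every
      choice.\<close>
    have "finite {X. X \<subseteq> {1..n} \<and> card X = k + 1}" by simp
    moreover have "{1..k + 1} \<in> {X. X \<subseteq> {1..n} \<and> card X = k + 1}" by (auto simp: n_def)
    ultimately obtain X where X: "X \<subseteq> {1..n}" "card X = k + 1"
      and max: "\<And>Y. Y \<subseteq> {1..n} \<Longrightarrow> card Y = k + 1 \<Longrightarrow> prod \<delta> Y \<le> prod \<delta> X"
      using ex_max_of_finite[of "{X. X \<subseteq> {1..n} \<and> card X = k + 1}" "prod \<delta>"] by blast
    \<comment> \<open>The classes cover \<open>F\<close> and are indexed by \<open>I\<close>, whose
      size depends only on \<open>k\<close>.\<close>
    define S where "S = (\<lambda>(\<sigma>, Y). {x \<in> F. good_list n (\<lambda>i. Q (\<sigma> ! i)) (\<lambda>i. A (\<sigma> ! i)) Y (tuple_list x \<sigma>)})"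
    have cardS: "real (card (S i)) \<le> 18 ^ n * \<Lambda> ^ K * prod \<delta> X * P" if "i \<in> I" for i
    proof -
      obtain \<sigma> Y where i: "i = (\<sigma>, Y)" by (cases i)
      have \<sigma>: "distinct \<sigma>" "set \<sigma> = {1..n}" and Y: "Y \<subseteq> {..<n}" "card Y = k + 1"
        using that by (auto simp: I_def i)
      have len: "length \<sigma> = n" using \<sigma> distinct_card by fastforce
      have mem: "\<sigma> ! i \<in> {1..n}" if "i < n" for i using \<sigma>(2) len that nth_mem by blast
      have bij: "bij_betw ((!) \<sigma>) {..<n} {1..n}" using bij_betw_nth[of \<sigma>] \<sigma> len by simp
      \<comment> \<open>A tuple is recovered from its list: \<open>\<sigma>\<close> runs through all
        indices, the functions are extensional, and \<open>nat\<close> is injective on positive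
        denominators.\<close>
      have inj: "inj_on (\<lambda>x. tuple_list x \<sigma>) F"
      proof (rule inj_onI)
        fix x y assume xy: "x \<in> F" "y \<in> F" "tuple_list x \<sigma> = tuple_list y \<sigma>"
        have ext: "fst z \<in> {1..n} \<rightarrow>\<^sub>E UNIV" "snd z \<in> {1..n} \<rightarrow>\<^sub>E UNIV" "\<And>i. i \<in> {1..n} \<Longrightarrow> snd z i \<ge> 1"
          if "z \<in> F" for z using that by (auto simp: F_def integral_fraction_tuples_def)
        have eq: "fst x i = fst y i" "nat (snd x i) = nat (snd y i)" if "i \<in> {1..n}" for i
          using xy(3) that \<sigma>(2) by (auto simp: tuple_list_def)
        have "fst x = fst y" using ext(1)[OF xy(1)] ext(1)[OF xy(2)] eq(1) by (rule PiE_ext)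
        moreover have "snd x = snd y"
        proof (rule PiE_ext[OF ext(2)[OF xy(1)] ext(2)[OF xy(2)]])
          fix i assume "i \<in> {1..n}"
          then show "snd x i = snd y i" using eq(2)[of i] ext(3)[OF xy(1), of i] ext(3)[OF xy(2), of i] by simp
        qed
        ultimately show "x = y" by (rule prod_eqI)
      qed
      have "S i \<subseteq> F" by (auto simp: S_def i)
      then have "card (S i) = card ((\<lambda>x. tuple_list x \<sigma>) ` S i)"
        using inj by (metis card_image inj_on_subset)
      also have "real \<dots> \<le> 18 ^ n * \<Lambda> ^ K * (\<Prod>i\<in>Y. measure lborel (A (\<sigma> ! i))) * (\<Prod>i<n. Q (\<sigma> ! i))"
        unfolding K_def
      proof (rule card_good_lists_le[where Q = "\<lambda>i. Q (\<sigma> ! i)" and A = "\<lambda>i. A (\<sigma> ! i)"])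
        show "finite ((\<lambda>x. tuple_list x \<sigma>) ` S i)" using finF \<open>S i \<subseteq> F\<close> by (auto intro: finite_subset)
        show "n > 0" by (simp add: n_def)
        fix m assume "m < n"
        note m = mem[OF this]
        show "admissible_interval (Q (\<sigma> ! m)) (A (\<sigma> ! m))"
          using h[OF m] by (simp add: admissible_interval_def)
        show "1 + ln (Q (\<sigma> ! m)) \<le> \<Lambda>" using QP[OF m] h(1)[OF m] by (simp add: \<Lambda>_def)
      qed (use Y in \<open>auto simp: S_def i\<close>)
      also have "(\<Prod>i\<in>Y. measure lborel (A (\<sigma> ! i))) = (\<Prod>i\<in>Y. \<delta> (\<sigma> ! i))"
        using h(4) mem Y by (intro prod.cong) auto
      also have "\<dots> = prod \<delta> ((!) \<sigma> ` Y)"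
        using inj_on_subset[OF bij_betw_imp_inj_on[OF bij] Y(1)] by (simp add: prod.reindex)
      also have "(\<Prod>i<n. Q (\<sigma> ! i)) = P"
        unfolding P_def by (rule prod.reindex_bij_betw[OF bij])
      also have "18 ^ n * \<Lambda> ^ K * prod \<delta> ((!) \<sigma> ` Y) * P \<le> 18 ^ n * \<Lambda> ^ K * prod \<delta> X * P"
      proof (intro mult_right_mono mult_left_mono max)
        show "(!) \<sigma> ` Y \<subseteq> {1..n}" using mem Y by auto
        show "card ((!) \<sigma> ` Y) = k + 1"
          using inj_on_subset[OF bij_betw_imp_inj_on[OF bij] Y(1)] Y(2) by (simp add: card_image)
      qed (use P1 in \<open>auto simp: \<Lambda>_def\<close>)
      finally show ?thesis .
    qed
    have "F \<subseteq> (\<Union>i\<in>I. S i)"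
    proof
      fix x assume x: "x \<in> F"
      obtain a q where aq: "x = (a, q)" by (cases x)
      then show "x \<in> (\<Union>i\<in>I. S i)"
        using exists_good_ordering[OF assms, of a q Q A] x unfolding F_def n_def[symmetric] I_def S_def by auto
    qed
    then have "card F \<le> card (\<Union>i\<in>I. S i)"
      using finI finF by (intro card_mono) (auto simp: S_def)
    also have "\<dots> \<le> (\<Sum>i\<in>I. card (S i))" using finI by (rule card_UN_le)
    finally have "real (card F) \<le> (\<Sum>i\<in>I. real (card (S i)))"
      by (metis of_nat_le_iff of_nat_sum)
    also have "\<dots> \<le> (\<Sum>i\<in>I. 18 ^ n * \<Lambda> ^ K * prod \<delta> X * P)" using cardS by (rule sum_mono)
    also have "\<dots> = real (card I) * 18 ^ n * \<Lambda> ^ K * (prod \<delta> X * P)" by simp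
    finally have bound: "real (card F) \<le> real (card I) * 18 ^ n * \<Lambda> ^ K * (prod \<delta> X * P)" .
    \<comment> \<open>When \<open>ln P\<close> is below 1 its powers may be arbitrarily small, even
      0 while tuples exist; the exponent 0 then suffices because \<open>\<Lambda> \<le> 2\<close>.
      Otherwise \<open>\<Lambda> \<le> 2 * ln P\<close>. In both cases the loss is at most
      \<open>2 ^ K\<close>.\<close>
    define e where "e = (if ln P \<ge> 1 then K else 0)"
    have "\<Lambda> ^ K \<le> 2 ^ K * ln P ^ e"
    proof (cases "ln P \<ge> 1")
      case True
      then have "\<Lambda> ^ K \<le> (2 * ln P) ^ K" by (intro power_mono) (auto simp: \<Lambda>_def)
      then show ?thesis using True by (simp add: e_def power_mult_distrib)
    next
      case False
      then have "\<Lambda> ^ K \<le> 2 ^ K" using P1 by (intro power_mono) (auto simp: \<Lambda>_def)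
      then show ?thesis using False by (simp add: e_def)
    qed
    moreover have "prod \<delta> X * P \<ge> 0" using \<delta>0 X P1 by (intro mult_nonneg_nonneg prod_nonneg) auto
    ultimately have "real (card I) * 18 ^ n * \<Lambda> ^ K * (prod \<delta> X * P)
        \<le> real (card I) * 18 ^ n * (2 ^ K * ln P ^ e) * (prod \<delta> X * P)"
      by (intro mult_right_mono mult_left_mono) auto
    then have "real (card F) \<le> C * ln P ^ e * prod \<delta> X * P"
      using bound by (simp add: C_def mult_ac)
    moreover have "e \<le> K" by (simp add: e_def)
    ultimately show "\<exists>X\<subseteq>{1..2*k+1}. card X = k + 1 \<and>
      (\<exists>e\<le>K. real (card (integral_fraction_tuples (2*k+1) Q A))
         \<le> C * ln (\<Prod>i=1..2*k+1. Q i) ^ e * (\<Prod>i\<in>X. \<delta> i) * (\<Prod>i=1..2*k+1. Q i))"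
      using X unfolding F_def P_def n_def by blast
  qed
qed

end
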